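(* Let $K \le 0$ be a real number and let $(X,d,m)$ be a $CD(K,\infty)$ space. Then for every continuous function $u \colon X \to \mathbb{R}$, every upper gradient $g$ of $u$, every point $x \in X$ and every radius $r > 0$, \[ \int_{B(x,r)} |u - \langle u\rangle_{B(x,r)}|\,dm \le 4 r e^{|K| r^2} \int_{B(x,2r)} g\,dm . \]
   Context: Standing assumptions: $(X,d,m)$ is a metric measure space, $(X,d)$ is a complete geodesic metric space, $m$ is a Borel measure on $X$ with support $X$. $B(x,r)=\{y : d(x,y)<r\}$, and $\langle u\rangle_{B} = \frac{1}{m(B)}\int_B u\,dm$ is the average of $u$ over the ball $B$ (which presupposes $0<m(B)<\infty$). Upper gradient: a Borel function $g\colon X \to [0,\infty]$ is an upper gradient of $u$ if for every constant speed curve $\gamma\colon[0,1]\to X$ with length $l(\gamma)<\infty$ one has $|u(\gamma(0))-u(\gamma(1))| \le l(\gamma)\int_0^1 g(\gamma(t))\,dt$. Geodesics: $\operatorname{Geo}(X)$ is the set of continuous $\gamma\colon[0,1]\to X$ with $d(\gamma(t),\gamma(s)) = |t-s|\,d(\gamma(0),\gamma(1))$ for all $s,t\in[0,1]$; $e_t(\gamma)=\gamma(t)$. Wasserstein space: $\mathcal{P}(X)$ is the set of Borel probability measures on $X$, and $W_2(\mu,\nu) = \left(\inf_\sigma \int_{X\times X} d(x,y)^2\,d\sigma(x,y)\right)^{1/2}$ (possibly $+\infty$), the infimum being over $\sigma\in\mathcal{P}(X\times X)$ with first marginal $\mu$ and second marginal $\nu$. $\operatorname{GeoOpt}(\mu,\nu)$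 is the set of $\pi\in\mathcal{P}(\operatorname{Geo}(X))$ such that $t\mapsto (e_t)_\#\pi$ is a (constant speed) geodesic in $(\mathcal{P}(X),W_2)$ from $\mu=(e_0)_\#\pi$ to $\nu=(e_1)_\#\pi$. Functionals: $\mathcal{DC}_\infty$ is the class of continuous convex $F\colon[0,\infty)\to\mathbb{R}$ with $F(0)=0$ such that $\lambda\mapsto e^\lambda F(e^{-\lambda})$ is convex on $(-\infty,\infty)$. For such $F$, set $F'(\infty)=\lim_{r\to\infty}F(r)/r$ and $\mathscr{F}(\mu)=\int_X F(\rho)\,dm + F'(\infty)\mu^\perp(X)$, where $\mu=\rho m+\mu^\perp$ is the Lebesgue decomposition of $\mu$ with respect to $m$. $CD(K,\infty)$ space: put $\beta_t(x,y)=e^{\frac16 K(1-t^2)d(x,y)^2}$. $(X,d,m)$ is a $CD(K,\infty)$ space if for any $\mu_0,\mu_1\in\mathcal{P}(X)$ with $W_2(\mu_0,\mu_1)<\infty$ there exists $\pi\in\operatorname{GeoOpt}(\mu_0,\mu_1)$ such that, with $\mu_t=(e_t)_\#\pi$, for every $F\in\mathcal{DC}_\infty$ and every $t\in[0,1]$, \[ \begin{aligned} \mathscr{F}(\mu_t)\le\;& (1-t)\iint_{X\times X}\beta_{1-t}(x_0,x_1)F\left(\tfrac{\rho_0(x_0)}{\beta_{1-t}(x_0,x_1)}\right)d\sigma(x_1|x_0)\,dm(x_0)\\ &+ t\iint_{X\times X}\beta_t(x_0,x_1)F\left(\tfrac{\rho_1(x_1)}{\beta_t(x_0,x_1)}\right)d\sigma(x_0|x_1)\,dm(x_1)\\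 &+F'(\infty)\left((1-t)\mu_0^\perp(X)+t\mu_1^\perp(X)\right), \end{aligned} \] where $\mu_i=\rho_i m+\mu_i^\perp$ is the Lebesgue decomposition with respect to $m$, $\sigma=(e_0,e_1)_\#\pi$, and $\sigma(\cdot|x_0)$, $\sigma(\cdot|x_1)$ denote the disintegrations of $\sigma$ with respect to $\mu_0$ and $\mu_1$. *)

theory Defs
  imports "HOL-Probability.Probability"
begin

text \<open>
  The space \<open>X\<close> is a type of class \<^class>\<open>complete_space\<close>; Borel measures on it are measures
  whose \<open>\<sigma>\<close>-algebra is that of \<^term>\<open>borel\<close>.
\<close>

section \<open>Metric measure spaces\<close>

text \<open>
  A curve defined on \<open>[0,1]\<close> is encoded as a bounded continuous function on the real line
  that is constant on either side of \<open>[0,1]\<close>. The distance of \<^type>\<open>bcontfun\<close> then is the supremum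
  distance over \<open>[0,1]\<close>, so that \<open>Geo\<close> carries the topology of uniform convergence.
\<close>

definition Geo :: "(real \<Rightarrow>\<^sub>C 'a::metric_space) set" where
  "Geo = {\<gamma>. (\<forall>s\<in>{0..1}. \<forall>t\<in>{0..1}.
                dist (apply_bcontfun \<gamma> t) (apply_bcontfun \<gamma> s)
                  = \<bar>t - s\<bar> * dist (apply_bcontfun \<gamma> 0) (apply_bcontfun \<gamma> 1)) \<and>
             (\<forall>t. apply_bcontfun \<gamma> t = apply_bcontfun \<gamma> (max 0 (min 1 t)))}"

definition geodesic_space :: "'a::metric_space itself \<Rightarrow> bool" where
  "geodesic_space _ \<longleftrightarrow>
     (\<forall>x y::'a. \<exists>\<gamma>\<in>Geo. apply_bcontfun \<gamma> 0 = x \<and> apply_bcontfun \<gamma> 1 = y)"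

definition support :: "'a::metric_space measure \<Rightarrow> 'a set" where
  "support m = {x. \<forall>r>0. emeasure m (ball x r) > 0}"

text \<open>
  Finiteness of the measure of balls is what makes averages over balls meaningful. Together with
  full support it makes \<open>m\<close> \<open>\<sigma>\<close>-finite and the space separable, hence
  Lebesgue decompositions and disintegrations exist.
\<close>

definition metric_measure_space :: "'a::complete_space measure \<Rightarrow> bool" where
  "metric_measure_space m \<longleftrightarrow>
     geodesic_space TYPE('a) \<and> sets m = sets borel \<and> support m = UNIV \<and>
     (\<forall>x r. emeasure m (ball x r) < \<infinity>)"

definition average :: "'a measure \<Rightarrow> 'a set \<Rightarrow> ('a \<Rightarrow> real) \<Rightarrow> real" where
  "average m B u = (LINT y:B|m. u y) / measure m B"


section \<open>Upper gradients\<close>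

definition curve_length :: "real \<Rightarrow> real \<Rightarrow> (real \<Rightarrow> 'a::metric_space) \<Rightarrow> ennreal" where
  "curve_length a b \<gamma> =
     (SUP (n, p) \<in> {(n::nat, p::nat \<Rightarrow> real). (\<forall>i\<le>n. p i \<in> {a..b}) \<and> (\<forall>i<n. p i \<le> p (Suc i))}.
        \<Sum>i<n. ennreal (dist (\<gamma> (p i)) (\<gamma> (p (Suc i)))))"

definition constant_speed_curve :: "(real \<Rightarrow> 'a::metric_space) \<Rightarrow> bool" where
  "constant_speed_curve \<gamma> \<longleftrightarrow> path \<gamma> \<and>
     (\<forall>s t. 0 \<le> s \<and> s \<le> t \<and> t \<le> 1 \<longrightarrow>
        curve_length s t \<gamma> = ennreal (t - s) * curve_length 0 1 \<gamma>)"

definition upper_gradient :: "('a::metric_space \<Rightarrow> ennreal) \<Rightarrow> ('a \<Rightarrow> real) \<Rightarrow> bool" where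
  "upper_gradient g u \<longleftrightarrow> g \<in> borel_measurable borel \<and>
     (\<forall>\<gamma>. constant_speed_curve \<gamma> \<and> curve_length 0 1 \<gamma> < \<infinity> \<longrightarrow>
        ennreal \<bar>u (\<gamma> 0) - u (\<gamma> 1)\<bar>
          \<le> curve_length 0 1 \<gamma> * (\<integral>\<^sup>+t\<in>{0..1}. g (\<gamma> t) \<partial>lborel))"


section \<open>Wasserstein space\<close>

definition borel_probs :: "'a::topological_space measure set" where
  "borel_probs = {\<mu>. sets \<mu> = sets borel \<and> prob_space \<mu>}"

definition couplings ::
    "'a::topological_space measure \<Rightarrow> 'a measure \<Rightarrow> ('a \<times> 'a) measure set" where
  "couplings \<mu> \<nu> = {\<sigma>\<in>borel_probs. distr \<sigma> borel fst = \<mu> \<and> distr \<sigma> borel snd = \<nu>}"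

definition ennreal_sqrt :: "ennreal \<Rightarrow> ennreal" where
  "ennreal_sqrt a = (if a = \<infinity> then \<infinity> else ennreal (sqrt (enn2real a)))"

definition W2 :: "'a::metric_space measure \<Rightarrow> 'a measure \<Rightarrow> ennreal" where
  "W2 \<mu> \<nu> = ennreal_sqrt
     (INF \<sigma>\<in>couplings \<mu> \<nu>. \<integral>\<^sup>+z. ennreal ((dist (fst z) (snd z))\<^sup>2) \<partial>\<sigma>)"

definition eval_push :: "real \<Rightarrow> (real \<Rightarrow>\<^sub>C 'a::metric_space) measure \<Rightarrow> 'a measure" where
  "eval_push t \<pi> = distr \<pi> borel (\<lambda>\<gamma>. apply_bcontfun \<gamma> t)"

definition endpoint_push ::
    "(real \<Rightarrow>\<^sub>C 'a::metric_space) measure \<Rightarrow> ('a \<times> 'a) measure" where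
  "endpoint_push \<pi> = distr \<pi> borel (\<lambda>\<gamma>. (apply_bcontfun \<gamma> 0, apply_bcontfun \<gamma> 1))"

text \<open>
  In the definition below \<open>W2 \<mu> \<nu> < \<infinity>\<close> is the continuity of the geodesic: given the constant
  speed identity, the two are equivalent.
\<close>

definition GeoOpt ::
    "'a::metric_space measure \<Rightarrow> 'a measure \<Rightarrow> (real \<Rightarrow>\<^sub>C 'a) measure set" where
  "GeoOpt \<mu> \<nu> = {\<pi>.
     sets \<pi> = sets (restrict_space borel Geo) \<and> prob_space \<pi> \<and>
     eval_push 0 \<pi> = \<mu> \<and> eval_push 1 \<pi> = \<nu> \<and> W2 \<mu> \<nu> < \<infinity> \<and>
     (\<forall>s\<in>{0..1}. \<forall>t\<in>{0..1}.
        W2 (eval_push t \<pi>) (eval_push s \<pi>) = ennreal \<bar>t - s\<bar> * W2 \<mu> \<nu>)}"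


section \<open>Lebesgue decomposition and disintegration\<close>

definition lebesgue_decomposition ::
    "'a measure \<Rightarrow> 'a measure \<Rightarrow> ('a \<Rightarrow> real) \<Rightarrow> 'a measure \<Rightarrow> bool" where
  "lebesgue_decomposition m \<mu> \<rho> \<nu> \<longleftrightarrow>
     \<rho> \<in> borel_measurable m \<and> (\<forall>x. 0 \<le> \<rho> x) \<and> sets \<nu> = sets m \<and>
     (\<exists>N\<in>sets m. emeasure m N = 0 \<and> emeasure \<nu> (space m - N) = 0) \<and>
     (\<forall>A\<in>sets m. emeasure \<mu> A = (\<integral>\<^sup>+x\<in>A. ennreal (\<rho> x) \<partial>m) + emeasure \<nu> A)"

text \<open>The density is unique up to \<open>m\<close>-null sets only; any version is chosen.\<close>

definition ac_density :: "'a measure \<Rightarrow> 'a measure \<Rightarrow> 'a \<Rightarrow> real" where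
  "ac_density m \<mu> = (SOME \<rho>. \<exists>\<nu>. lebesgue_decomposition m \<mu> \<rho> \<nu>)"

definition singular_part :: "'a measure \<Rightarrow> 'a measure \<Rightarrow> 'a measure" where
  "singular_part m \<mu> = (SOME \<nu>. \<exists>\<rho>. lebesgue_decomposition m \<mu> \<rho> \<nu>)"

text \<open>\<open>\<kappa> x\<close> is the conditional law of the second coordinate given that the first one is \<open>x\<close>.\<close>

definition disintegration ::
    "('a::topological_space \<times> 'a) measure \<Rightarrow> 'a measure \<Rightarrow> ('a \<Rightarrow> 'a measure) \<Rightarrow> bool" where
  "disintegration \<sigma> \<mu> \<kappa> \<longleftrightarrow> \<kappa> \<in> borel \<rightarrow>\<^sub>M prob_algebra borel \<and>
     (\<forall>C\<in>sets borel. emeasure \<sigma> C = (\<integral>\<^sup>+x. emeasure (\<kappa> x) {y. (x, y) \<in> C} \<partial>\<mu>))"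


section \<open>Functionals and the curvature-dimension condition\<close>

definition DC_infty :: "(real \<Rightarrow> real) set" where
  "DC_infty = {F. continuous_on {0..} F \<and> convex_on {0..} F \<and> F 0 = 0 \<and>
     convex_on UNIV (\<lambda>l. exp l * F (exp (- l)))}"

definition slope_at_infinity :: "(real \<Rightarrow> real) \<Rightarrow> ereal" where
  "slope_at_infinity F = Lim at_top (\<lambda>r. ereal (F r / r))"

text \<open>
  The integrands \<open>F(\<rho>)\<close> have no sign, and \<open>m\<close> may be infinite, so the integrals are taken as
  positive minus negative part in the extended reals and may be undefined. The conventions make the
  \<open>CD\<close> inequality void in that case: the left-hand side \<open>entropy_functional\<close> is set to \<open>-\<infinity>\<close>
  as soon as the negative part has infinite integral (which is its actual value whenever it is
  defined), and on the right-hand side \<open>\<infinity> - \<infinity> = \<infinity>\<close>, as in \<^typ>\<open>ereal\<close>.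
  Note also that \<open>\<infinity> * 0 = 0\<close> in \<^typ>\<open>ereal\<close>, and that \<^term>\<open>ennreal a\<close> is \<open>0\<close> for negative \<open>a\<close>.
\<close>

definition entropy_functional :: "'a measure \<Rightarrow> (real \<Rightarrow> real) \<Rightarrow> 'a measure \<Rightarrow> ereal" where
  "entropy_functional m F \<mu> =
     (let \<rho> = ac_density m \<mu>;
          pos = \<integral>\<^sup>+x. ennreal (F (\<rho> x)) \<partial>m;
          neg = \<integral>\<^sup>+x. ennreal (- F (\<rho> x)) \<partial>m
      in if neg = \<infinity> then - \<infinity>
         else enn2ereal pos - enn2ereal neg
              + slope_at_infinity F * enn2ereal (emeasure (singular_part m \<mu>) (space m)))"

definition iterated_integral ::
    "'a measure \<Rightarrow> ('a \<Rightarrow> 'b measure) \<Rightarrow> ('a \<Rightarrow> 'b \<Rightarrow> real) \<Rightarrow> ereal" where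
  "iterated_integral m \<kappa> f =
     enn2ereal (\<integral>\<^sup>+x. (\<integral>\<^sup>+y. ennreal (f x y) \<partial>\<kappa> x) \<partial>m)
     - enn2ereal (\<integral>\<^sup>+x. (\<integral>\<^sup>+y. ennreal (- f x y) \<partial>\<kappa> x) \<partial>m)"

definition CD_beta :: "real \<Rightarrow> real \<Rightarrow> 'a::metric_space \<Rightarrow> 'a \<Rightarrow> real" where
  "CD_beta K t x y = exp (1/6 * K * (1 - t\<^sup>2) * (dist x y)\<^sup>2)"

text \<open>
  The disintegrations exist and are unique up to null sets (the space is Polish), and
  \<open>F(0) = 0\<close>, so quantifying them existentially is the same as fixing a version.
\<close>

definition CD_infty :: "real \<Rightarrow> 'a::complete_space measure \<Rightarrow> bool" where
  "CD_infty K m \<longleftrightarrow> metric_measure_space m \<and>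
     (\<forall>\<mu>0\<in>borel_probs. \<forall>\<mu>1\<in>borel_probs. W2 \<mu>0 \<mu>1 < \<infinity> \<longrightarrow>
       (\<exists>\<pi>\<in>GeoOpt \<mu>0 \<mu>1. \<exists>\<kappa>0 \<kappa>1.
          disintegration (endpoint_push \<pi>) \<mu>0 \<kappa>0 \<and>
          disintegration (distr (endpoint_push \<pi>) borel prod.swap) \<mu>1 \<kappa>1 \<and>
          (\<forall>F\<in>DC_infty. \<forall>t\<in>{0..1}.
             entropy_functional m F (eval_push t \<pi>) \<le>
               ereal (1 - t) * iterated_integral m \<kappa>0 (\<lambda>x0 x1.
                 CD_beta K (1 - t) x0 x1 * F (ac_density m \<mu>0 x0 / CD_beta K (1 - t) x0 x1))
               + ereal t * iterated_integral m \<kappa>1 (\<lambda>x1 x0.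
                 CD_beta K t x0 x1 * F (ac_density m \<mu>1 x1 / CD_beta K t x0 x1))
               + slope_at_infinity F *
                   (ereal (1 - t) * enn2ereal (emeasure (singular_part m \<mu>0) UNIV)
                    + ereal t * enn2ereal (emeasure (singular_part m \<mu>1) UNIV)))))"

end

theory Submission
  imports Defs
begin

text \<open>
  Split the ball \<open>B = B(x, r)\<close> at a median \<open>b\<close> of \<open>u\<close> into an upper and a lower half of equal mass and
  transport one onto the other, both normalised to probability measures with density at
  most \<open>2 / m(B)\<close>. Since \<open>u \<ge> b\<close> at one end and \<open>u \<le> b\<close> at the other end of almost every transport
  geodesic \<open>\<gamma>\<close>, the integral of \<open>\<bar>u - b\<bar>\<close> over \<open>B\<close> is \<open>m(B) / 2\<close> times the mean of
  \<open>\<bar>u (\<gamma> 0) - u (\<gamma> 1)\<bar>\<close>, hence at most \<open>m(B) r\<close> times the integral over \<open>t\<close> of the mean of \<open>g (\<gamma> t)\<close>.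
  The geodesics stay in \<open>B(x, 2 r)\<close>, so everything follows if the law of \<open>\<gamma> t\<close> has density at most
  \<open>2 / m(B)\<close> times \<open>exp (\<bar>K\<bar> (2 r)\<^sup>2 / 6)\<close>: this gives the constant \<open>2 r exp (2 \<bar>K\<bar> r\<^sup>2 / 3)\<close>, and
  passing from the median to the mean doubles it (\<open>CD_infty_transport_estimate\<close>,
  \<open>CD_infty_deviation_from_median\<close>, \<open>mean_deviation_le\<close>).

  The density bound \<open>CD_infty_density_bound\<close> is the only place where curvature enters. The function
  \<open>F(r) = r log\<^sup>+ (r / c)\<close> belongs to \<^const>\<open>DC_infty\<close>; its functional is nonnegative, and it is zero exactly at
  the measures that are at most \<open>c m\<close>. With \<open>c\<close> equal to the above bound the right-hand side of the
  curvature condition is zero, because \<open>\<beta>\<close> does not push the initial and final densities above \<open>c\<close>.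
  Hence every intermediate measure is at most \<open>c m\<close>.

  A measure of full support that is finite on balls forces separability of the space. Therefore
  product measures on \<open>X \<times> X\<close> are Borel, and the two halves of the ball have finite Wasserstein
  distance, as the curvature condition demands.
\<close>


section \<open>Separability and product Borel algebras\<close>

text \<open>
  The basis is a parameter and not a property of the type, because the spaces considered here owe
  their separability to the measure they carry. A countable basis of one factor is enough, because
  an open set \<open>W\<close> of the product is the countable union of the rectangles \<open>U \<times> V\<close> with \<open>U\<close> basic and \<open>V\<close> the largest open set such that \<open>U \<times> V \<subseteq> W\<close>.
  It is applied to \<open>X \<times> X\<close> and to the product of the time line with a space of curves, which
  need not be separable.
\<close>

lemma sets_borel_prod_countable_basis:
  fixes \<B> :: "'a::topological_space set set"
  assumes "countable \<B>" "topological_basis \<B>"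
  shows "sets (borel \<Otimes>\<^sub>M borel :: ('a \<times> 'b::topological_space) measure) = sets borel"
proof
  show "sets (borel \<Otimes>\<^sub>M borel :: ('a \<times> 'b) measure) \<subseteq> sets borel"
  proof -
    have *: "A \<times> B \<in> sets (borel :: ('a \<times> 'b) measure)"
      if "A \<in> sets borel" "B \<in> sets borel" for A :: "'a set" and B :: "'b set"
    proof -
      have "fst -` A \<inter> space borel \<in> sets (borel :: ('a \<times> 'b) measure)"
        using that(1) by (intro measurable_sets[OF borel_measurable_continuous_onI] continuous_intros)
      moreover have "snd -` B \<inter> space borel \<in> sets (borel :: ('a \<times> 'b) measure)"
        using that(2) by (intro measurable_sets[OF borel_measurable_continuous_onI] continuous_intros)
      ultimately have "(fst -` A \<inter> space borel) \<inter> (snd -` B \<inter> space borel) \<in> sets (borel :: ('a \<times> 'b) measure)"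
        by (rule sets.Int)
      moreover have "(fst -` A \<inter> space borel) \<inter> (snd -` B \<inter> space borel) = A \<times> B"
        by auto
      ultimately show ?thesis by simp
    qed
    have "{A \<times> B | A B. A \<in> sets borel \<and> B \<in> sets borel} \<subseteq> sets (borel :: ('a \<times> 'b) measure)"
      by clarify (rule *)
    then show ?thesis
      unfolding sets_pair_measure space_borel UNIV_Times_UNIV
      by (rule sets.sigma_sets_subset[of _ borel, unfolded space_borel])
  qed
  show "sets borel \<subseteq> sets (borel \<Otimes>\<^sub>M borel :: ('a \<times> 'b) measure)"
  proof -
    have "W \<in> sets (borel \<Otimes>\<^sub>M borel)" if W: "open W" for W :: "('a \<times> 'b) set"
    proof -
      define V where "V = (\<lambda>U. \<Union>{V. open V \<and> U \<times> V \<subseteq> W})"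
      have "W = (\<Union>U\<in>\<B>. U \<times> V U)"
      proof (intro equalityI subsetI)
        fix z assume "z \<in> W"
        with W obtain A B where AB: "open A" "open B" "z \<in> A \<times> B" "A \<times> B \<subseteq> W"
          by (rule open_prod_elim)
        moreover obtain U where "U \<in> \<B>" "fst z \<in> U" "U \<subseteq> A"
          using AB assms(2) by (metis mem_Times_iff topological_basisE)
        ultimately have "z \<in> U \<times> V U" unfolding V_def by (auto simp: mem_Times_iff)
        with \<open>U \<in> \<B>\<close> show "z \<in> (\<Union>U\<in>\<B>. U \<times> V U)" by blast
      qed (auto simp: V_def)
      moreover have "U \<times> V U \<in> sets (borel \<Otimes>\<^sub>M borel)" if "U \<in> \<B>" for U
        using assms(2) that
        by (intro pair_measureI borel_open) (auto simp: V_def topological_basis_open)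
      ultimately show ?thesis using assms(1) by (auto intro!: sets.countable_UN')
    qed
    then have "Collect open \<subseteq> sets (borel \<Otimes>\<^sub>M borel :: ('a \<times> 'b) measure)" by auto
    from sets.sigma_sets_subset[OF this] show ?thesis
      by (simp add: space_pair_measure borel_def)
  qed
qed

lemma maximal_separated_set_exists:
  fixes \<epsilon> :: real
  shows "\<exists>S::'a::metric_space set. (\<forall>x\<in>S. \<forall>y\<in>S. x \<noteq> y \<longrightarrow> \<epsilon> \<le> dist x y) \<and>
           (\<forall>x. x \<in> S \<or> (\<exists>y\<in>S. dist x y < \<epsilon>))"
proof -
  define \<A> where "\<A> = {S::'a set. \<forall>x\<in>S. \<forall>y\<in>S. x \<noteq> y \<longrightarrow> \<epsilon> \<le> dist x y}"
  have "\<exists>S\<in>\<A>. \<forall>T\<in>\<A>. S \<subseteq> T \<longrightarrow> T = S"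
  proof (rule subset_Zorn')
    fix \<C> assume C: "subset.chain \<A> \<C>"
    show "\<Union>\<C> \<in> \<A>"
      unfolding \<A>_def
    proof (clarify)
      fix x y S T assume "x \<in> S" "S \<in> \<C>" "y \<in> T" "T \<in> \<C>" "x \<noteq> y"
      moreover have "S \<subseteq> T \<or> T \<subseteq> S" "S \<in> \<A>" "T \<in> \<A>"
        using C \<open>S \<in> \<C>\<close> \<open>T \<in> \<C>\<close> unfolding subset.chain_def subset_chain_def by blast+
      ultimately show "\<epsilon> \<le> dist x y" unfolding \<A>_def by blast
    qed
  qed
  then obtain S where S: "S \<in> \<A>" and max: "\<And>T. T \<in> \<A> \<Longrightarrow> S \<subseteq> T \<Longrightarrow> T = S" by blast
  have "x \<in> S \<or> (\<exists>y\<in>S. dist x y < \<epsilon>)" for x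
  proof (rule ccontr)
    assume H: "\<not> (x \<in> S \<or> (\<exists>y\<in>S. dist x y < \<epsilon>))"
    then have far: "\<epsilon> \<le> dist x y" "\<epsilon> \<le> dist y x" if "y \<in> S" for y
      using that by (auto simp: not_less dist_commute[of y x])
    have "insert x S \<in> \<A>"
      using S far unfolding \<A>_def mem_Collect_eq by (metis insert_iff)
    then have "insert x S = S" by (rule max) auto
    with H show False by auto
  qed
  with S show ?thesis unfolding \<A>_def by blast
qed

text \<open>
  Half-radius balls around the points are disjoint and of positive measure, and those centred in a
  bounded set lie in one ball, of finite measure. A summable family of positive numbers is countable.
\<close>

lemma countable_separated_set:
  fixes m :: "'a::metric_space measure" and S :: "'a set"
  assumes m: "sets m = sets borel" "support m = UNIV" "\<And>x r. emeasure m (ball x r) < \<infinity>"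
    and "0 < \<epsilon>" and sep: "\<And>x y. x \<in> S \<Longrightarrow> y \<in> S \<Longrightarrow> x \<noteq> y \<Longrightarrow> \<epsilon> \<le> dist x y"
  shows "countable S"
proof -
  fix z :: 'a
  have pos: "measure m (ball y (\<epsilon> / 2)) \<noteq> 0" for y
  proof -
    have "emeasure m (ball y (\<epsilon> / 2)) > 0"
    proof -
      have "y \<in> support m" using m(2) by simp
      then show ?thesis using \<open>0 < \<epsilon>\<close> unfolding support_def by (auto dest: spec[of _ "\<epsilon> / 2"])
    qed
    with m(3)[of y "\<epsilon> / 2"] show ?thesis by (auto simp: measure_def enn2real_eq_0_iff)
  qed
  have [measurable]: "ball y r \<in> sets m" for y r unfolding m(1) by simp
  have "countable (S \<inter> ball z (real n))" for n
  proof -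
    define A where "A = S \<inter> ball z (real n)"
    have "sum (\<lambda>y. measure m (ball y (\<epsilon> / 2))) F \<le> measure m (ball z (real n + \<epsilon>))"
      if F: "F \<subseteq> A" "finite F" for F
    proof -
      have disj: "disjoint_family_on (\<lambda>y. ball y (\<epsilon> / 2)) F"
        unfolding disjoint_family_on_def
      proof (intro ballI impI)
        fix x y assume "x \<in> F" "y \<in> F" "x \<noteq> y"
        then have "\<epsilon> \<le> dist x y" using F(1) sep unfolding A_def by auto
        then show "ball x (\<epsilon> / 2) \<inter> ball y (\<epsilon> / 2) = {}"
          by (intro disjoint_ballI) simp
      qed
      have "sum (\<lambda>y. measure m (ball y (\<epsilon> / 2))) F = measure m (\<Union>y\<in>F. ball y (\<epsilon> / 2))"
        using F(2) disj m(3) by (intro measure_finite_Union[symmetric]) (auto simp: less_top[symmetric])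
      also have "\<dots> \<le> measure m (ball z (real n + \<epsilon>))"
      proof (rule measure_mono_fmeasurable)
        show "(\<Union>y\<in>F. ball y (\<epsilon> / 2)) \<subseteq> ball z (real n + \<epsilon>)"
        proof clarify
          fix w y assume "y \<in> F" "w \<in> ball y (\<epsilon> / 2)"
          moreover have "y \<in> ball z (real n)" using \<open>y \<in> F\<close> F(1) unfolding A_def by auto
          ultimately show "w \<in> ball z (real n + \<epsilon>)"
            using dist_triangle[of z w y] \<open>0 < \<epsilon>\<close> by (auto simp: field_simps)
        qed
        show "(\<Union>y\<in>F. ball y (\<epsilon> / 2)) \<in> sets m" using F(2) by (intro sets.finite_UN) auto
        show "ball z (real n + \<epsilon>) \<in> fmeasurable m" using m(3) by (intro fmeasurableI) auto
      qed
      finally show ?thesis .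
    qed
    then have "(\<lambda>y. measure m (ball y (\<epsilon> / 2))) summable_on A"
      by (intro nonneg_bdd_above_summable_on bdd_aboveI2) auto
    then have "countable {y \<in> A. measure m (ball y (\<epsilon> / 2)) \<noteq> 0}"
      by (rule summable_countable_real)
    moreover have "{y \<in> A. measure m (ball y (\<epsilon> / 2)) \<noteq> 0} = A" using pos by auto
    ultimately show ?thesis unfolding A_def by simp
  qed
  moreover have "S = (\<Union>n. S \<inter> ball z (real n))"
    using reals_Archimedean2 by auto
  ultimately show ?thesis by (metis countable_UN countableI_type)
qed

text \<open>
  A maximal \<open>1/n\<close>-separated set is a countable \<open>1/n\<close>-net; the balls of radius \<open>1/n\<close> around these
  points form a basis.
\<close>

lemma countable_basis_of_full_support:
  fixes m :: "'a::metric_space measure"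
  assumes m: "sets m = sets borel" "support m = UNIV" "\<And>x r. emeasure m (ball x r) < \<infinity>"
  shows "\<exists>\<B>::'a set set. countable \<B> \<and> topological_basis \<B>"
proof -
  have "\<exists>S::'a set. countable S \<and> (\<forall>x. \<exists>y\<in>S. dist x y < 1 / real (Suc n))" for n
  proof -
    obtain S :: "'a set" where S: "\<forall>x\<in>S. \<forall>y\<in>S. x \<noteq> y \<longrightarrow> 1 / real (Suc n) \<le> dist x y"
      and dense: "\<forall>x. x \<in> S \<or> (\<exists>y\<in>S. dist x y < 1 / real (Suc n))"
      using maximal_separated_set_exists[of "1 / real (Suc n)"] by blast
    have "\<exists>y\<in>S. dist x y < 1 / real (Suc n)" for x
    proof (cases "x \<in> S")
      case True then show ?thesis by (intro bexI[of _ x]) auto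
    qed (use dense in blast)
    moreover have "countable S"
      by (rule countable_separated_set[OF m, of "1 / real (Suc n)"]) (use S in auto)
    ultimately show ?thesis by blast
  qed
  then obtain S :: "nat \<Rightarrow> 'a set" where
    S: "\<And>n. countable (S n)" "\<And>n x. \<exists>y\<in>S n. dist x y < 1 / real (Suc n)"
    by metis
  define \<B> where "\<B> = (\<Union>n. (\<lambda>y. ball y (1 / real (Suc n))) ` S n)"
  have "countable \<B>" unfolding \<B>_def using S(1) by auto
  moreover have "topological_basis \<B>"
  proof (rule topological_basisI)
    fix U and x :: 'a assume "open U" "x \<in> U"
    then obtain e where e: "e > 0" "ball x e \<subseteq> U" by (meson openE)
    obtain n where n: "1 / real (Suc n) < e / 2"
      using nat_approx_posE[of "e / 2"] e(1) by auto
    obtain y where y: "y \<in> S n" "dist x y < 1 / real (Suc n)" using S(2) by blast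
    have "ball y (1 / real (Suc n)) \<subseteq> ball x e"
    proof
      fix w assume "w \<in> ball y (1 / real (Suc n))"
      then show "w \<in> ball x e" using dist_triangle[of x w y] n y(2) by auto
    qed
    with e(2) y show "\<exists>B'\<in>\<B>. x \<in> B' \<and> B' \<subseteq> U"
      unfolding \<B>_def by (intro bexI[of _ "ball y (1 / real (Suc n))"]) (auto simp: dist_commute)
  qed (auto simp: \<B>_def)
  ultimately show ?thesis by blast
qed

section \<open>Existence and uniqueness of the Lebesgue decomposition\<close>

text \<open>
  The singular part is the restriction of \<open>\<mu>\<close> to an \<open>m\<close>-null set \<open>N\<close> of maximal \<open>\<mu>\<close>-measure.
  By maximality \<open>\<mu>\<close> vanishes on the null sets outside \<open>N\<close>, so the Radon-Nikodym theorem applies there.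
\<close>

lemma lebesgue_decomposition_exists:
  assumes "sigma_finite_measure m" "finite_measure \<mu>" "sets \<mu> = sets m"
  shows "\<exists>\<rho> \<nu>. lebesgue_decomposition m \<mu> \<rho> \<nu>"
proof -
  interpret m: sigma_finite_measure m by fact
  interpret \<mu>: finite_measure \<mu> by fact
  have [measurable_cong]: "sets \<mu> = sets m" and sp: "space \<mu> = space m"
    using assms(3) by (auto dest: sets_eq_imp_space_eq)
  have "null_sets m \<noteq> {}" by auto
  then obtain a :: "nat \<Rightarrow> ennreal" where a: "range a \<subseteq> emeasure \<mu> ` null_sets m"
    "Sup (emeasure \<mu> ` null_sets m) = Sup (range a)"
    using ennreal_SUP_countable_SUP by metis
  then have "\<forall>k. \<exists>A. A \<in> null_sets m \<and> a k = emeasure \<mu> A" by blast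
  then obtain Z where Z: "\<And>k. Z k \<in> null_sets m" "\<And>k. a k = emeasure \<mu> (Z k)" by metis
  define N where "N = (\<Union>k::nat. Z k)"
  have N: "N \<in> null_sets m" unfolding N_def using Z(1) by auto
  then have [measurable]: "N \<in> sets m" by auto
  have max: "emeasure \<mu> A \<le> emeasure \<mu> N" if "A \<in> null_sets m" for A
  proof -
    have "emeasure \<mu> A \<le> Sup (range a)" unfolding a(2)[symmetric] using that by (intro SUP_upper) auto
    also have "\<dots> \<le> emeasure \<mu> N"
      unfolding Z(2) N_def using Z(1) assms(3)
      by (intro SUP_least emeasure_mono) (auto intro!: sets.countable_UN)
    finally show ?thesis .
  qed
  define \<mu>' where "\<mu>' = density \<mu> (indicator (space m - N))"
  define \<nu> where "\<nu> = density \<mu> (indicator N)"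
  have e': "emeasure \<mu>' A = emeasure \<mu> (A - N)" if [measurable]: "A \<in> sets m" for A
  proof -
    have "emeasure \<mu>' A = (\<integral>\<^sup>+x. indicator (space m - N) x * indicator A x \<partial>\<mu>)"
      unfolding \<mu>'_def by (rule emeasure_density) measurable
    also have "\<dots> = (\<integral>\<^sup>+x. indicator (A - N) x \<partial>\<mu>)"
      by (intro nn_integral_cong) (auto simp: sp split: split_indicator)
    finally have "emeasure \<mu>' A = (\<integral>\<^sup>+x. indicator (A - N) x \<partial>\<mu>)" .
    then show ?thesis by simp
  qed
  have e\<nu>: "emeasure \<nu> A = emeasure \<mu> (A \<inter> N)" if [measurable]: "A \<in> sets m" for A
  proof -
    have "emeasure \<nu> A = (\<integral>\<^sup>+x. indicator N x * indicator A x \<partial>\<mu>)"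
      unfolding \<nu>_def by (rule emeasure_density) measurable
    also have "\<dots> = (\<integral>\<^sup>+x. indicator (A \<inter> N) x \<partial>\<mu>)"
      by (intro nn_integral_cong) (auto split: split_indicator)
    finally have "emeasure \<nu> A = (\<integral>\<^sup>+x. indicator (A \<inter> N) x \<partial>\<mu>)" .
    then show ?thesis by simp
  qed
  have "absolutely_continuous m \<mu>'"
    unfolding absolutely_continuous_def
  proof
    fix A assume A: "A \<in> null_sets m"
    then have [measurable]: "A \<in> sets m" by auto
    have "emeasure \<mu> N + emeasure \<mu> (A - N) = emeasure \<mu> (N \<union> (A - N))"
      by (intro plus_emeasure) auto
    also have "\<dots> \<le> emeasure \<mu> N"
      using A N by (intro max) auto
    finally have "emeasure \<mu> (A - N) = 0"
      using \<mu>.emeasure_finite[of N]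
      by (metis add.right_neutral ennreal_add_left_cancel_le le_zero_eq infinity_ennreal_def)
    then show "A \<in> null_sets \<mu>'" using e'[of A] by (auto simp: null_sets_def \<mu>'_def)
  qed
  then obtain f where f[measurable]: "f \<in> borel_measurable m" and fd: "density m f = \<mu>'"
    using m.Radon_Nikodym[of \<mu>'] assms(3) unfolding \<mu>'_def by auto
  have "(\<integral>\<^sup>+x. f x \<partial>m) = emeasure \<mu>' (space m)"
    unfolding fd[symmetric] by (subst emeasure_density) (auto intro!: nn_integral_cong)
  also have "\<dots> < \<infinity>" unfolding e'[OF sets.top] by (simp add: less_top[symmetric])
  finally have "AE x in m. f x \<noteq> \<infinity>" by (intro nn_integral_PInf_AE) auto
  then have fin: "AE x in m. ennreal (enn2real (f x)) = f x" by (auto simp: less_top)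
  have "emeasure \<mu> A = (\<integral>\<^sup>+x\<in>A. ennreal (enn2real (f x)) \<partial>m) + emeasure \<nu> A"
    if [measurable]: "A \<in> sets m" for A
  proof -
    have "(\<integral>\<^sup>+x\<in>A. ennreal (enn2real (f x)) \<partial>m) = (\<integral>\<^sup>+x\<in>A. f x \<partial>m)"
      using fin by (intro nn_integral_cong_AE) auto
    also have "\<dots> = emeasure \<mu> (A - N)"
      using emeasure_density[OF f that] e'[OF that] unfolding fd by simp
    also have "\<dots> + emeasure \<mu> (A \<inter> N) = emeasure \<mu> A"
    proof -
      have "(A - N) \<inter> (A \<inter> N) = {}" "(A - N) \<union> (A \<inter> N) = A" by auto
      then show ?thesis using plus_emeasure[of "A - N" \<mu> "A \<inter> N"] by simp
    qed
    finally show ?thesis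
      unfolding e\<nu>[OF that] by simp
  qed
  moreover have "emeasure m N = 0" using N by auto
  moreover have "emeasure \<nu> (space m - N) = 0"
    by (subst e\<nu>) (auto simp: Diff_Int_distrib2)
  ultimately have "lebesgue_decomposition m \<mu> (\<lambda>x. enn2real (f x)) \<nu>"
    unfolding lebesgue_decomposition_def using assms(3) by (auto simp: \<nu>_def)
  then show ?thesis by blast
qed

lemma lebesgue_decomposition_of_density:
  assumes "sigma_finite_measure m" and f[measurable]: "f \<in> borel_measurable m"
    and dec: "lebesgue_decomposition m (density m f) \<rho> \<nu>"
  shows "emeasure \<nu> (space m) = 0" and "AE x in m. ennreal (\<rho> x) = f x"
proof -
  interpret m: sigma_finite_measure m by fact
  have [measurable]: "\<rho> \<in> borel_measurable m" and [measurable_cong]: "sets \<nu> = sets m"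
    and split: "\<And>A. A \<in> sets m \<Longrightarrow> emeasure (density m f) A = (\<integral>\<^sup>+x\<in>A. ennreal (\<rho> x) \<partial>m) + emeasure \<nu> A"
    using dec unfolding lebesgue_decomposition_def by auto
  obtain N where [measurable]: "N \<in> sets m" and N: "emeasure m N = 0" "emeasure \<nu> (space m - N) = 0"
    using dec unfolding lebesgue_decomposition_def by auto
  have "N \<in> null_sets m" using N by auto
  then have "emeasure (density m f) N = 0"
    using absolutely_continuousI_density[OF f] unfolding absolutely_continuous_def by auto
  then have "emeasure \<nu> N = 0" using split[of N] by simp
  moreover have "emeasure \<nu> (space m) \<le> emeasure \<nu> N + emeasure \<nu> (space m - N)"
    using sets.sets_into_space[of N m] by (subst plus_emeasure) (auto intro!: emeasure_mono)
  ultimately show \<nu>0: "emeasure \<nu> (space m) = 0" using N by simp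
  have "density m f = density m (\<lambda>x. ennreal (\<rho> x))"
  proof (rule measure_eqI)
    fix A assume "A \<in> sets (density m f)"
    then have [measurable]: "A \<in> sets m" by simp
    have "emeasure \<nu> A \<le> emeasure \<nu> (space m)"
      using sets.sets_into_space[of A m] by (intro emeasure_mono) auto
    then have "emeasure \<nu> A = 0" using \<nu>0 by simp
    then show "emeasure (density m f) A = emeasure (density m (\<lambda>x. ennreal (\<rho> x))) A"
      using split[of A] by (simp add: emeasure_density)
  qed simp
  then show "AE x in m. ennreal (\<rho> x) = f x"
    by (subst (asm) m.density_unique_iff) (auto elim: eventually_mono)
qed

text \<open>
  The density and the singular part are chosen by two independent applications of choice, so a priori
  they belong to two different decompositions.
\<close>

lemma
  assumes "sigma_finite_measure m" "finite_measure \<mu>" "sets \<mu> = sets m"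
  shows ac_density_decomposition: "\<exists>\<nu>. lebesgue_decomposition m \<mu> (ac_density m \<mu>) \<nu>"
    and singular_part_decomposition: "\<exists>\<rho>. lebesgue_decomposition m \<mu> \<rho> (singular_part m \<mu>)"
proof -
  show "\<exists>\<nu>. lebesgue_decomposition m \<mu> (ac_density m \<mu>) \<nu>"
    unfolding ac_density_def using lebesgue_decomposition_exists[OF assms] by (rule someI_ex)
  have "\<exists>\<nu> \<rho>. lebesgue_decomposition m \<mu> \<rho> \<nu>"
    using lebesgue_decomposition_exists[OF assms] by blast
  then show "\<exists>\<rho>. lebesgue_decomposition m \<mu> \<rho> (singular_part m \<mu>)"
    unfolding singular_part_def by (rule someI_ex)
qed

lemma
  assumes "sigma_finite_measure m" "finite_measure (density m f)" "f \<in> borel_measurable m"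
  shows ac_density_of_density: "AE x in m. ennreal (ac_density m (density m f) x) = f x"
    and singular_part_of_density: "emeasure (singular_part m (density m f)) (space m) = 0"
proof -
  note * = ac_density_decomposition[OF assms(1,2)] singular_part_decomposition[OF assms(1,2)]
  show "AE x in m. ennreal (ac_density m (density m f) x) = f x"
    using * lebesgue_decomposition_of_density(2)[OF assms(1,3)] by auto
  show "emeasure (singular_part m (density m f)) (space m) = 0"
    using * lebesgue_decomposition_of_density(1)[OF assms(1,3)] by auto
qed

text \<open>
  The decomposition that contains \<^const>\<open>singular_part\<close> presents \<open>\<mu>\<close> as absolutely continuous; the
  uniqueness of densities then carries this over to the version chosen by \<^const>\<open>ac_density\<close>.
\<close>

lemma density_of_singular_part_null:
  assumes "sigma_finite_measure m" "finite_measure \<mu>" "sets \<mu> = sets m"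
    and null: "emeasure (singular_part m \<mu>) (space m) = 0"
  shows "\<mu> = density m (\<lambda>x. ennreal (ac_density m \<mu> x))"
proof -
  obtain \<rho> where dec: "lebesgue_decomposition m \<mu> \<rho> (singular_part m \<mu>)"
    using singular_part_decomposition[OF assms(1-3)] by blast
  then have [measurable]: "\<rho> \<in> borel_measurable m" and s: "sets (singular_part m \<mu>) = sets m"
    and split: "\<And>A. A \<in> sets m \<Longrightarrow> emeasure \<mu> A = (\<integral>\<^sup>+x\<in>A. ennreal (\<rho> x) \<partial>m) + emeasure (singular_part m \<mu>) A"
    unfolding lebesgue_decomposition_def by auto
  have \<mu>: "\<mu> = density m (\<lambda>x. ennreal (\<rho> x))"
  proof (rule measure_eqI)
    fix A assume "A \<in> sets \<mu>"
    then have A: "A \<in> sets m" using assms(3) by simp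
    then have "emeasure (singular_part m \<mu>) A \<le> emeasure (singular_part m \<mu>) (space m)"
      using sets.sets_into_space[of A m] s by (intro emeasure_mono) auto
    then show "emeasure \<mu> A = emeasure (density m (\<lambda>x. ennreal (\<rho> x))) A"
      using split[OF A] null A by (simp add: emeasure_density)
  qed (simp add: assms(3))
  have "AE x in m. ennreal (ac_density m \<mu> x) = ennreal (\<rho> x)"
    using ac_density_of_density[OF assms(1), of "\<lambda>x. ennreal (\<rho> x)"] assms(2)
    unfolding \<mu>[symmetric] by simp
  moreover have "ac_density m \<mu> \<in> borel_measurable m"
    using ac_density_decomposition[OF assms(1-3)] unfolding lebesgue_decomposition_def by auto
  ultimately have "density m (\<lambda>x. ennreal (ac_density m \<mu> x)) = density m (\<lambda>x. ennreal (\<rho> x))"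
    by (intro density_cong) auto
  with \<mu> show ?thesis by simp
qed

section \<open>An entropy that detects large densities\<close>

text \<open>
  The function \<open>r log\<^sup>+ (r / c)\<close>. It is zero exactly on \<open>[0, c]\<close>, while its slope at infinity is
  infinite, so its entropy is an obstruction both to densities above \<open>c\<close> and to a singular part. The
  form with \<^const>\<open>max\<close> inside the logarithm makes it continuous at \<open>0\<close> by inspection.
\<close>

definition log_excess :: "real \<Rightarrow> real \<Rightarrow> real" where
  "log_excess c r = r * ln (max 1 (r / c))"

lemma log_excess_nonneg: "0 \<le> r \<Longrightarrow> 0 \<le> log_excess c r"
  unfolding log_excess_def by simp

lemma log_excess_eq_0_iff:
  assumes "0 < c" "0 \<le> r"
  shows "log_excess c r = 0 \<longleftrightarrow> r \<le> c"
proof -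
  have "ln (max 1 (r / c)) = 0 \<longleftrightarrow> r / c \<le> 1"
    by (subst ln_eq_zero_iff) (auto simp: max_def)
  also have "r / c \<le> 1 \<longleftrightarrow> r \<le> c" using assms by (simp add: field_simps)
  finally show ?thesis unfolding log_excess_def using assms by auto
qed

lemma log_excess_measurable[measurable]: "log_excess c \<in> borel_measurable borel"
  unfolding log_excess_def by measurable

text \<open>
  Where the function is positive, its graph has the tangent of \<open>r ln (r / c)\<close>, and this tangent
  stays below the function on the whole half-line.
\<close>

lemma convex_on_log_excess:
  assumes "0 < c"
  shows "convex_on {0..} (log_excess c)"
proof -
  have tangent: "x * (ln (z / c) + 1) - z \<le> log_excess c x" if "0 \<le> x" "c < z" for x z
  proof (cases "x = 0")
    case True
    then show ?thesis using that assms by (simp add: log_excess_def)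
  next
    case False
    with that have "0 < x" "0 < z" using assms by auto
    have "ln (z / x) \<le> z / x - 1" using \<open>0 < x\<close> \<open>0 < z\<close> by (intro ln_le_minus_one) auto
    then have "x * ln (z / x) \<le> z - x"
      using mult_left_mono[of "ln (z / x)" "z / x - 1" x] \<open>0 < x\<close> by (simp add: field_simps)
    moreover have "ln (z / c) = ln (z / x) + ln (x / c)"
      using \<open>0 < x\<close> \<open>0 < z\<close> assms by (simp add: ln_div)
    ultimately have "x * (ln (z / c) + 1) - z \<le> x * ln (x / c)" by (simp add: algebra_simps)
    also have "\<dots> \<le> log_excess c x"
      unfolding log_excess_def using \<open>0 < x\<close> assms by (intro mult_left_mono) auto
    finally show ?thesis .
  qed
  show ?thesis
  proof (rule convex_onI)
    fix t x y :: real
    assume t: "0 < t" "t < 1" and xy: "x \<in> {0..}" "y \<in> {0..}"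
    define z where "z = (1 - t) * x + t * y"
    have "0 \<le> z" unfolding z_def using t xy by auto
    have "log_excess c z \<le> (1 - t) * log_excess c x + t * log_excess c y"
    proof (cases "z \<le> c")
      case True
      then have "log_excess c z = 0" using log_excess_eq_0_iff[OF assms \<open>0 \<le> z\<close>] by simp
      then show ?thesis using t xy log_excess_nonneg by simp
    next
      case False
      have "(1 - t) * (x * (ln (z / c) + 1) - z) \<le> (1 - t) * log_excess c x"
        using t xy False by (intro mult_left_mono tangent) auto
      moreover have "t * (y * (ln (z / c) + 1) - z) \<le> t * log_excess c y"
        using t xy False by (intro mult_left_mono tangent) auto
      moreover have "(1 - t) * (x * (ln (z / c) + 1) - z) + t * (y * (ln (z / c) + 1) - z) = z * ln (z / c)"
        unfolding z_def by (simp add: algebra_simps)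
      moreover have "max 1 (z / c) = z / c" using False assms by (auto simp: field_simps max_def)
      ultimately show ?thesis unfolding log_excess_def[of c z] by simp
    qed
    then show "log_excess c ((1 - t) *\<^sub>R x + t *\<^sub>R y) \<le> (1 - t) * log_excess c x + t * log_excess c y"
      unfolding z_def by simp
  qed simp
qed

text \<open>
  In the logarithmic variable the function becomes \<open>max 0 (- l - ln c)\<close>, a maximum of two affine functions.
\<close>

lemma log_excess_DC_infty:
  assumes "0 < c"
  shows "log_excess c \<in> DC_infty"
proof -
  have "exp l * log_excess c (exp (- l)) = max 0 (- l - ln c)" for l
  proof -
    have "exp l * log_excess c (exp (- l)) = ln (max 1 (exp (- l) / c))"
      unfolding log_excess_def by (simp add: exp_minus)
    also have "\<dots> = max (ln 1) (ln (exp (- l) / c))"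
      using assms by (auto simp: max_def)
    also have "\<dots> = max 0 (- l - ln c)"
      using assms by (simp add: ln_div)
    finally show ?thesis .
  qed
  moreover have "convex_on UNIV (\<lambda>l::real. max 0 (- l - ln c))"
  proof (rule convex_onI)
    fix t x y :: real assume "0 < t" "t < 1"
    then have "(1 - t) * 0 \<le> (1 - t) * max 0 (- x - ln c)" "t * 0 \<le> t * max 0 (- y - ln c)"
      "(1 - t) * (- x - ln c) \<le> (1 - t) * max 0 (- x - ln c)" "t * (- y - ln c) \<le> t * max 0 (- y - ln c)"
      by (intro mult_left_mono; simp)+
    then show "max 0 (- ((1 - t) *\<^sub>R x + t *\<^sub>R y) - ln c) \<le> (1 - t) * max 0 (- x - ln c) + t * max 0 (- y - ln c)"
      by (intro max.boundedI) (simp_all add: algebra_simps)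
  qed simp
  moreover have "continuous_on {0..} (log_excess c)"
    unfolding log_excess_def by (intro continuous_intros) (use assms in \<open>auto simp: max_def\<close>)
  ultimately show ?thesis
    unfolding DC_infty_def using convex_on_log_excess[OF assms] by (simp add: log_excess_def)
qed

lemma slope_at_infinity_log_excess:
  assumes "0 < c"
  shows "slope_at_infinity (log_excess c) = \<infinity>"
  unfolding slope_at_infinity_def
proof (rule tendsto_Lim)
  have "filterlim (\<lambda>r. r / c) at_top at_top"
    using assms unfolding divide_inverse
    by (intro filterlim_at_top_mult_tendsto_pos[OF tendsto_const _ filterlim_ident]) auto
  then have "filterlim (\<lambda>r. ln (r / c)) at_top at_top"
    by (rule filterlim_compose[OF ln_at_top])
  moreover have "\<forall>\<^sub>F r in at_top. ln (r / c) \<le> log_excess c r / r"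
    using eventually_gt_at_top[of 0]
  proof eventually_elim
    case (elim r)
    then show ?case using assms unfolding log_excess_def by simp
  qed
  ultimately have "filterlim (\<lambda>r. log_excess c r / r) at_top at_top"
    by (rule filterlim_at_top_mono)
  then show "((\<lambda>r. ereal (log_excess c r / r)) \<longlongrightarrow> \<infinity>) at_top"
    by (simp add: tendsto_PInfty_eq_at_top)
qed simp

section \<open>Density bounds from the curvature-dimension condition\<close>

lemma metric_measure_space_sigma_finite:
  assumes "metric_measure_space m"
  shows "sigma_finite_measure m"
proof
  fix z :: 'a
  have m: "sets m = sets borel" "space m = UNIV" "\<And>x r. emeasure m (ball x r) < \<infinity>"
    using assms unfolding metric_measure_space_def by (auto dest: sets_eq_imp_space_eq)
  have "(\<Union>n. ball z (real n)) = UNIV" using reals_Archimedean2 by (auto simp: set_eq_iff)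
  then show "\<exists>A. countable A \<and> A \<subseteq> sets m \<and> \<Union> A = space m \<and> (\<forall>a\<in>A. emeasure m a \<noteq> \<infinity>)"
    using m by (intro exI[of _ "range (\<lambda>n. ball z (real n))"]) (auto simp: less_top[symmetric])
qed

text \<open>
  The entropy of \<^term>\<open>log_excess c\<close> is a sum of two nonnegative terms,
  so both vanish: the first gives \<open>\<rho> \<le> c\<close> almost everywhere, and the second, in which the mass of the
  singular part is multiplied by \<open>\<infinity>\<close>, gives absolute continuity. Together they say
  that \<open>\<mu> \<le> c m\<close>.
\<close>

lemma nn_integral_le_of_entropy_nonpos:
  assumes "sigma_finite_measure m" "finite_measure \<mu>" "sets \<mu> = sets m" "0 < c"
    and ent: "entropy_functional m (log_excess c) \<mu> \<le> 0"
    and h: "h \<in> borel_measurable m"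
  shows "(\<integral>\<^sup>+x. h x \<partial>\<mu>) \<le> ennreal c * (\<integral>\<^sup>+x. h x \<partial>m)"
proof -
  define \<rho> where "\<rho> = ac_density m \<mu>"
  define s where "s = emeasure (singular_part m \<mu>) (space m)"
  define p where "p = (\<integral>\<^sup>+x. ennreal (log_excess c (\<rho> x)) \<partial>m)"
  have \<rho>[measurable]: "\<rho> \<in> borel_measurable m" and \<rho>0: "\<And>x. 0 \<le> \<rho> x"
    using ac_density_decomposition[OF assms(1-3)] unfolding lebesgue_decomposition_def \<rho>_def by auto
  have "(\<integral>\<^sup>+x. ennreal (- log_excess c (\<rho> x)) \<partial>m) = 0"
    using log_excess_nonneg[OF \<rho>0] by (simp add: ennreal_neg)
  then have sum: "enn2ereal p + \<infinity> * enn2ereal s \<le> 0"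
    using ent slope_at_infinity_log_excess[OF \<open>0 < c\<close>]
    unfolding entropy_functional_def by (simp add: Let_def \<rho>_def s_def p_def zero_ennreal.rep_eq)
  have nonneg: "0 \<le> enn2ereal p" "0 \<le> \<infinity> * enn2ereal s"
    by (rule enn2ereal_nonneg) (rule ereal_0_le_mult, simp, rule enn2ereal_nonneg)
  have "enn2ereal p \<le> enn2ereal p + \<infinity> * enn2ereal s"
    using add_left_mono[OF nonneg(2), of "enn2ereal p"] by simp
  with sum nonneg have "enn2ereal p = 0" by (metis order.antisym order.trans)
  then have "p = 0" by (metis enn2ereal_inject zero_ennreal.rep_eq)
  have "\<infinity> * enn2ereal s \<le> enn2ereal p + \<infinity> * enn2ereal s"
    using add_right_mono[OF nonneg(1), of "\<infinity> * enn2ereal s"] by simp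
  with sum nonneg have "\<infinity> * enn2ereal s = 0" by (metis order.antisym order.trans)
  then have "\<not> 0 < enn2ereal s" by (auto split: if_splits)
  then have "enn2ereal s = 0" using enn2ereal_nonneg[of s] by simp
  then have "s = 0" by (metis enn2ereal_inject zero_ennreal.rep_eq)
  have "AE x in m. ennreal (log_excess c (\<rho> x)) = 0"
    using \<open>p = 0\<close> unfolding p_def by (subst (asm) nn_integral_0_iff_AE) auto
  then have "AE x in m. ennreal (\<rho> x) \<le> ennreal c"
  proof eventually_elim
    case (elim x)
    then have "log_excess c (\<rho> x) = 0"
      using log_excess_nonneg[OF \<rho>0, of c x] by (simp add: ennreal_eq_0_iff)
    then show ?case using log_excess_eq_0_iff[OF \<open>0 < c\<close> \<rho>0] by (simp add: ennreal_leI)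
  qed
  have "\<mu> = density m (\<lambda>x. ennreal (\<rho> x))"
    using density_of_singular_part_null[OF assms(1-3)] \<open>s = 0\<close> unfolding \<rho>_def s_def .
  then have "(\<integral>\<^sup>+x. h x \<partial>\<mu>) = (\<integral>\<^sup>+x. ennreal (\<rho> x) * h x \<partial>m)"
    using h by (simp add: nn_integral_density)
  also have "\<dots> \<le> (\<integral>\<^sup>+x. ennreal c * h x \<partial>m)"
    using \<open>AE x in m. ennreal (\<rho> x) \<le> ennreal c\<close>
    by (intro nn_integral_mono_AE) (auto intro: mult_right_mono elim!: eventually_mono)
  also have "\<dots> = ennreal c * (\<integral>\<^sup>+x. h x \<partial>m)" using h by (rule nn_integral_cmult)
  finally show ?thesis .
qed

text \<open>
  The right-hand side of the curvature condition vanishes for this integrand if \<open>\<rho> / \<beta> \<le> c\<close> at almost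
  every pair of points, which holds as soon as \<open>c \<beta>\<close> is at least the bound \<open>L\<close> of the density. The
  kernel \<open>\<kappa>\<close> is controlled up to \<open>\<mu>\<close>-null sets only, but where \<open>\<rho> = 0\<close> the integrand vanishes
  whatever \<open>\<kappa>\<close> is, and elsewhere \<open>\<mu>\<close>-null sets are \<open>m\<close>-null.
\<close>

lemma iterated_integral_log_excess_eq_0:
  assumes m: "sigma_finite_measure m" "sets m = sets borel"
    and f: "f \<in> borel_measurable m" "finite_measure (density m f)"
    and f_le: "\<And>x. f x \<le> ennreal L * indicator B x" and B: "B \<in> sets borel"
    and dis: "disintegration \<sigma> (density m f) \<kappa>" and \<sigma>: "sets \<sigma> = sets borel" "AE z in \<sigma>. snd z \<in> B"
    and c: "0 < c" "0 \<le> L" and \<beta>: "\<And>x y. 0 < \<beta> x y" "\<And>x y. x \<in> B \<Longrightarrow> y \<in> B \<Longrightarrow> L \<le> c * \<beta> x y"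
  shows "iterated_integral m \<kappa>
           (\<lambda>x y. \<beta> x y * log_excess c (ac_density m (density m f) x / \<beta> x y)) = 0"
proof -
  define \<rho> where "\<rho> = ac_density m (density m f)"
  have [measurable]: "B \<in> sets borel" by fact
  have [measurable]: "\<kappa> \<in> borel \<rightarrow>\<^sub>M subprob_algebra borel"
    using dis unfolding disintegration_def by (auto intro: measurable_prob_algebraD)
  have \<rho>0: "0 \<le> \<rho> x" for x
    using ac_density_decomposition[OF m(1) f(2)] unfolding lebesgue_decomposition_def \<rho>_def by auto
  have \<rho>f: "AE x in m. ennreal (\<rho> x) = f x"
    unfolding \<rho>_def by (rule ac_density_of_density[OF m(1) f(2,1)])
  have "snd -` (- B) \<inter> space borel \<in> sets (borel :: ('a \<times> 'a) measure)"
    by (intro measurable_sets[OF borel_measurable_continuous_onI] continuous_intros) auto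
  then have C: "{z. snd z \<notin> B} \<in> sets (borel :: ('a \<times> 'a) measure)"
    by (simp add: vimage_def Collect_neg_eq[symmetric])
  have "emeasure \<sigma> {z. snd z \<notin> B} = 0"
    using \<sigma> C sets_eq_imp_space_eq[OF \<sigma>(1)] by (subst (asm) AE_iff_measurable[of "{z. snd z \<notin> B}"]) auto
  then have "(\<integral>\<^sup>+x. emeasure (\<kappa> x) {y. y \<notin> B} \<partial>density m f) = 0"
    using dis C unfolding disintegration_def by auto
  moreover have "(\<lambda>x. emeasure (\<kappa> x) {y. y \<notin> B}) \<in> borel_measurable (density m f)"
    unfolding Collect_neg_eq using m(2) by (subst measurable_cong_sets[of _ borel _ borel]) auto
  ultimately have "AE x in density m f. emeasure (\<kappa> x) {y. y \<notin> B} = 0"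
    by (subst (asm) nn_integral_0_iff_AE) auto
  then have "AE x in m. 0 < f x \<longrightarrow> emeasure (\<kappa> x) {y. y \<notin> B} = 0"
    using f(1) by (subst (asm) AE_density) auto
  with \<rho>f have vanish: "AE x in m. AE y in \<kappa> x. \<beta> x y * log_excess c (\<rho> x / \<beta> x y) = 0"
  proof eventually_elim
    case (elim x)
    show ?case
    proof (cases "\<rho> x = 0")
      case True
      then show ?thesis by (simp add: log_excess_def)
    next
      case False
      then have "0 < \<rho> x" using \<rho>0[of x] by simp
      then have "0 < f x" using elim(1) by (metis ennreal_less_zero_iff)
      then have x: "x \<in> B" using f_le[of x] by (auto split: split_indicator_asm)
      then have "\<rho> x \<le> L"
        using f_le[of x] elim(1)[symmetric] c(2) by (simp add: ennreal_le_iff)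
      have "sets (\<kappa> x) = sets borel" by (rule sets_kernel[of _ borel]) auto
      then have "AE y in \<kappa> x. y \<in> B"
        using elim(2) \<open>0 < f x\<close> sets_eq_imp_space_eq[of "\<kappa> x" borel]
        by (subst AE_iff_measurable[of "{y. y \<notin> B}"]) (auto simp: Collect_neg_eq)
      then show ?thesis
      proof eventually_elim
        case (elim y)
        have "\<rho> x / \<beta> x y \<le> c"
          using \<open>\<rho> x \<le> L\<close> \<beta>(2)[OF x elim] \<beta>(1)[of x y] by (simp add: pos_divide_le_eq)
        then show ?case
          using log_excess_eq_0_iff[OF c(1), of "\<rho> x / \<beta> x y"] \<rho>0[of x] \<beta>(1)[of x y] by simp
      qed
    qed
  qed
  \<comment> \<open>The factor \<open>a = 1\<close> gives the positive part of the integrand, \<open>a = - 1\<close> the negative part.\<close>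
  have zero: "(\<integral>\<^sup>+x. (\<integral>\<^sup>+y. ennreal (a * (\<beta> x y * log_excess c (\<rho> x / \<beta> x y))) \<partial>\<kappa> x) \<partial>m) = 0" for a
  proof -
    have "(\<integral>\<^sup>+x. (\<integral>\<^sup>+y. ennreal (a * (\<beta> x y * log_excess c (\<rho> x / \<beta> x y))) \<partial>\<kappa> x) \<partial>m) = (\<integral>\<^sup>+x. 0 \<partial>m)"
    proof (rule nn_integral_cong_AE, use vanish in eventually_elim)
      case (elim x)
      then have "(\<integral>\<^sup>+y. ennreal (a * (\<beta> x y * log_excess c (\<rho> x / \<beta> x y))) \<partial>\<kappa> x) = (\<integral>\<^sup>+y. 0 \<partial>\<kappa> x)"
        by (intro nn_integral_cong_AE) (auto elim!: eventually_mono)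
      then show ?case by simp
    qed
    then show ?thesis by simp
  qed
  show ?thesis
    unfolding iterated_integral_def \<rho>_def[symmetric] using zero[of 1] zero[of "-1"]
    by (simp add: zero_ennreal.rep_eq)
qed

lemma continuous_on_eval_bcontfun:
  "continuous_on UNIV (\<lambda>\<gamma>::'b::topological_space \<Rightarrow>\<^sub>C 'a::metric_space. apply_bcontfun \<gamma> t)"
  unfolding continuous_on_iff using dist_fun_lt_imp_dist_val_lt by blast

lemma eval_bcontfun_measurable:
  assumes "sets \<pi> = sets (restrict_space borel Geo)"
  shows "(\<lambda>\<gamma>. apply_bcontfun \<gamma> t) \<in> \<pi> \<rightarrow>\<^sub>M borel"
proof -
  have "(\<lambda>\<gamma>::real \<Rightarrow>\<^sub>C 'a. apply_bcontfun \<gamma> t) \<in> borel \<rightarrow>\<^sub>M borel"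
    by (rule borel_measurable_continuous_onI[OF continuous_on_eval_bcontfun])
  then show ?thesis
    using assms by (subst measurable_cong_sets[OF assms refl]) (rule measurable_restrict_space1)
qed

lemma endpoints_measurable:
  assumes "sets \<pi> = sets (restrict_space borel Geo)"
  shows "(\<lambda>\<gamma>. (apply_bcontfun \<gamma> 0, apply_bcontfun \<gamma> 1)) \<in> \<pi> \<rightarrow>\<^sub>M borel"
proof -
  have "(\<lambda>\<gamma>::real \<Rightarrow>\<^sub>C 'a. (apply_bcontfun \<gamma> 0, apply_bcontfun \<gamma> 1)) \<in> borel \<rightarrow>\<^sub>M borel"
    by (intro borel_measurable_continuous_onI continuous_on_Pair continuous_on_eval_bcontfun)
  then show ?thesis
    using assms by (subst measurable_cong_sets[OF assms refl]) (rule measurable_restrict_space1)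
qed

text \<open>
  Evaluation is jointly continuous in the curve and the time, but the measures live on the product
  \<open>\<sigma>\<close>-algebra, so deducing measurability from continuity uses the countable basis of the real line.
  This is what makes exchanging the integrals over curves and over time possible.
\<close>

lemma joint_eval_bcontfun_measurable:
  assumes \<pi>: "sets \<pi> = sets (restrict_space borel Geo)"
  shows "(\<lambda>(\<gamma>, t). apply_bcontfun \<gamma> t) \<in> \<pi> \<Otimes>\<^sub>M lborel \<rightarrow>\<^sub>M (borel :: 'a::metric_space measure)"
proof -
  have "continuous_on UNIV (\<lambda>z :: real \<times> (real \<Rightarrow>\<^sub>C 'a). apply_bcontfun (snd z) (fst z))"
    unfolding continuous_on_iff
  proof (intro ballI allI impI)
    fix z :: "real \<times> (real \<Rightarrow>\<^sub>C 'a)" and e :: real assume "0 < e"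
    have "continuous_on UNIV (apply_bcontfun (snd z))" by simp
    then obtain \<delta> where \<delta>: "0 < \<delta>" and
      near: "\<And>s. dist s (fst z) < \<delta> \<Longrightarrow> dist (apply_bcontfun (snd z) s) (apply_bcontfun (snd z) (fst z)) < e / 2"
      unfolding continuous_on_iff using \<open>0 < e\<close> by (metis UNIV_I half_gt_zero)
    have "dist (apply_bcontfun (snd w) (fst w)) (apply_bcontfun (snd z) (fst z)) < e"
      if w: "dist w z < min \<delta> (e / 2)" for w
    proof -
      have "dist (apply_bcontfun (snd w) (fst w)) (apply_bcontfun (snd z) (fst w)) < e / 2"
        using dist_bounded[of "snd w" "fst w" "snd z"] dist_snd_le[of w z] w by simp
      moreover have "dist (apply_bcontfun (snd z) (fst w)) (apply_bcontfun (snd z) (fst z)) < e / 2"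
        using dist_fst_le[of w z] w by (intro near) simp
      ultimately show ?thesis
        using dist_triangle[of "apply_bcontfun (snd w) (fst w)" "apply_bcontfun (snd z) (fst z)"
            "apply_bcontfun (snd z) (fst w)"] by linarith
    qed
    then show "\<exists>d>0. \<forall>w\<in>UNIV. dist w z < d \<longrightarrow>
        dist (apply_bcontfun (snd w) (fst w)) (apply_bcontfun (snd z) (fst z)) < e"
      using \<delta> \<open>0 < e\<close> by (intro exI[of _ "min \<delta> (e / 2)"]) auto
  qed
  then have eval: "(\<lambda>z :: real \<times> (real \<Rightarrow>\<^sub>C 'a). apply_bcontfun (snd z) (fst z)) \<in> borel \<rightarrow>\<^sub>M borel"
    by (rule borel_measurable_continuous_onI)
  obtain \<B> :: "real set set" where \<B>: "countable \<B>" "topological_basis \<B>"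
    using ex_countable_basis by blast
  have "(\<lambda>\<gamma>. \<gamma>) \<in> \<pi> \<rightarrow>\<^sub>M borel"
    by (subst measurable_cong_sets[OF \<pi> refl]) (simp add: measurable_restrict_space1)
  then have "(\<lambda>z. (snd z, fst z)) \<in> \<pi> \<Otimes>\<^sub>M lborel \<rightarrow>\<^sub>M (borel \<Otimes>\<^sub>M borel :: (real \<times> (real \<Rightarrow>\<^sub>C 'a)) measure)"
    by (intro measurable_Pair) (auto intro: measurable_compose[OF measurable_fst] measurable_snd)
  then have "(\<lambda>z. (snd z, fst z)) \<in> \<pi> \<Otimes>\<^sub>M lborel \<rightarrow>\<^sub>M (borel :: (real \<times> (real \<Rightarrow>\<^sub>C 'a)) measure)"
    by (subst (asm) measurable_cong_sets[OF refl sets_borel_prod_countable_basis[OF \<B>]])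
  from measurable_compose[OF this eval] show ?thesis by (simp add: case_prod_beta')
qed

text \<open>
  The product measure is a coupling of finite cost. That it is a Borel measure on \<open>X \<times> X\<close> uses the
  countable basis.
\<close>

lemma W2_finite_of_bounded:
  fixes \<mu>0 \<mu>1 :: "'a::metric_space measure" and \<B> :: "'a set set"
  assumes \<B>: "countable \<B>" "topological_basis \<B>"
    and \<mu>: "\<mu>0 \<in> borel_probs" "\<mu>1 \<in> borel_probs" "AE x in \<mu>0. x \<in> B" "AE x in \<mu>1. x \<in> B"
    and D: "\<And>x y. x \<in> B \<Longrightarrow> y \<in> B \<Longrightarrow> dist x y \<le> D"
  shows "W2 \<mu>0 \<mu>1 < \<infinity>"
proof -
  have s: "sets \<mu>0 = sets borel" "sets \<mu>1 = sets borel" and p: "prob_space \<mu>0" "prob_space \<mu>1"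
    using \<mu> unfolding borel_probs_def by auto
  interpret p0: prob_space \<mu>0 by fact
  interpret p1: prob_space \<mu>1 by fact
  define \<sigma> where "\<sigma> = \<mu>0 \<Otimes>\<^sub>M \<mu>1"
  interpret \<sigma>: prob_space \<sigma> unfolding \<sigma>_def by (rule prob_space_pair[OF p])
  have "sets \<sigma> = sets (borel \<Otimes>\<^sub>M borel)" unfolding \<sigma>_def by (intro sets_pair_measure_cong s)
  then have s\<sigma>: "sets \<sigma> = sets borel" using sets_borel_prod_countable_basis[OF \<B>] by simp
  have "distr \<sigma> borel fst = distr (\<mu>0 \<Otimes>\<^sub>M \<mu>1) \<mu>0 fst"
    unfolding \<sigma>_def using s by (intro distr_cong) auto
  then have d0: "distr \<sigma> borel fst = \<mu>0" by (simp add: p1.distr_pair_fst)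
  have "distr \<sigma> borel snd = distr (\<mu>0 \<Otimes>\<^sub>M \<mu>1) \<mu>1 snd"
    unfolding \<sigma>_def using s by (intro distr_cong) auto
  also have "\<dots> = \<mu>1"
  proof (rule measure_eqI)
    fix A assume "A \<in> sets (distr (\<mu>0 \<Otimes>\<^sub>M \<mu>1) \<mu>1 snd)"
    then have A: "A \<in> sets \<mu>1" by simp
    then have "snd -` A \<inter> space (\<mu>0 \<Otimes>\<^sub>M \<mu>1) = space \<mu>0 \<times> A"
      using sets.sets_into_space by (auto simp: space_pair_measure)
    with A show "emeasure (distr (\<mu>0 \<Otimes>\<^sub>M \<mu>1) \<mu>1 snd) A = emeasure \<mu>1 A"
      by (simp add: emeasure_distr p1.emeasure_pair_measure_Times p0.emeasure_space_1)
  qed simp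
  finally have d1: "distr \<sigma> borel snd = \<mu>1" .
  have "\<sigma> \<in> couplings \<mu>0 \<mu>1"
    unfolding couplings_def borel_probs_def using s\<sigma> d0 d1 \<sigma>.prob_space_axioms by auto
  have m: "fst \<in> \<sigma> \<rightarrow>\<^sub>M borel" "snd \<in> \<sigma> \<rightarrow>\<^sub>M borel"
    unfolding \<sigma>_def using s measurable_fst[of \<mu>0 \<mu>1] measurable_snd[of \<mu>0 \<mu>1]
    by (simp_all cong: measurable_cong_sets)
  have "AE z in \<sigma>. fst z \<in> B" by (rule AE_distrD[OF m(1) \<mu>(3)[folded d0]])
  moreover have "AE z in \<sigma>. snd z \<in> B" by (rule AE_distrD[OF m(2) \<mu>(4)[folded d1]])
  ultimately have "AE z in \<sigma>. ennreal ((dist (fst z) (snd z))\<^sup>2) \<le> ennreal (D\<^sup>2)"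
  proof eventually_elim
    case (elim z)
    then show ?case by (intro ennreal_leI power_mono D) auto
  qed
  then have "(\<integral>\<^sup>+z. ennreal ((dist (fst z) (snd z))\<^sup>2) \<partial>\<sigma>) \<le> (\<integral>\<^sup>+z. ennreal (D\<^sup>2) \<partial>\<sigma>)"
    by (rule nn_integral_mono_AE)
  also have "\<dots> < \<infinity>" by (simp add: \<sigma>.emeasure_space_1)
  finally have "(INF \<sigma>\<in>couplings \<mu>0 \<mu>1. \<integral>\<^sup>+z. ennreal ((dist (fst z) (snd z))\<^sup>2) \<partial>\<sigma>) < \<infinity>"
    using \<open>\<sigma> \<in> couplings \<mu>0 \<mu>1\<close> by (meson INF_lower le_less_trans)
  moreover have "ennreal_sqrt a < \<infinity>" if "a < \<infinity>" for a
    using that by (simp add: ennreal_sqrt_def)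
  ultimately show ?thesis unfolding W2_def by blast
qed

text \<open>
  The curvature condition provides one plan that works for all functions of \<^const>\<open>DC_infty\<close> at
  once; inserting \<^term>\<open>log_excess c\<close> bounds the densities of all intermediate measures. The
  threshold is \<open>c = L exp (\<bar>K\<bar> D\<^sup>2 / 6)\<close> because \<open>exp (- \<bar>K\<bar> D\<^sup>2 / 6)\<close> is a lower bound of \<open>\<beta>\<close>
  on pairs at distance at most \<open>D\<close>.
\<close>

lemma CD_infty_density_bound:
  fixes m :: "'a::complete_space measure"
  assumes CD: "CD_infty K m" and "K \<le> 0" and "0 < L"
    and B: "B \<in> sets borel" and D: "\<And>x y. x \<in> B \<Longrightarrow> y \<in> B \<Longrightarrow> dist x y \<le> D"
    and f0: "f0 \<in> borel_measurable borel" "\<And>x. f0 x \<le> ennreal L * indicator B x" "(\<integral>\<^sup>+x. f0 x \<partial>m) = 1"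
    and f1: "f1 \<in> borel_measurable borel" "\<And>x. f1 x \<le> ennreal L * indicator B x" "(\<integral>\<^sup>+x. f1 x \<partial>m) = 1"
  shows "\<exists>\<pi>\<in>GeoOpt (density m f0) (density m f1). \<forall>t\<in>{0..1}. \<forall>h\<in>borel_measurable borel.
           (\<integral>\<^sup>+x. h x \<partial>eval_push t \<pi>) \<le> ennreal (L * exp (\<bar>K\<bar> * D\<^sup>2 / 6)) * (\<integral>\<^sup>+x. h x \<partial>m)"
proof -
  have mms: "metric_measure_space m" using CD unfolding CD_infty_def by blast
  then have sm: "sets m = sets borel" and supp: "support m = UNIV"
    and fin: "\<And>x r. emeasure m (ball x r) < \<infinity>"
    unfolding metric_measure_space_def by auto
  have spm: "space m = UNIV" using sets_eq_imp_space_eq[OF sm] by simp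
  obtain \<B> :: "'a set set" where \<B>: "countable \<B>" "topological_basis \<B>"
    using countable_basis_of_full_support[OF sm supp fin] by blast
  interpret m: sigma_finite_measure m by (rule metric_measure_space_sigma_finite[OF mms])
  have f[measurable]: "f0 \<in> borel_measurable m" "f1 \<in> borel_measurable m"
    using f0(1) f1(1) sm by (simp_all cong: measurable_cong_sets)
  have prob: "prob_space (density m f0)" "prob_space (density m f1)"
    using f0(3) f1(3) by (auto intro!: prob_spaceI simp: emeasure_density cong: nn_integral_cong)
  then have fm: "finite_measure (density m f0)" "finite_measure (density m f1)"
    by (auto intro: prob_space.axioms)
  have bp: "density m f0 \<in> borel_probs" "density m f1 \<in> borel_probs"
    unfolding borel_probs_def using prob sm by auto
  have AE_B: "AE x in density m f. x \<in> B"
    if "f \<in> borel_measurable m" "\<And>x. f x \<le> ennreal L * indicator B x" for f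
  proof -
    have "x \<in> B" if "0 < f x" for x
      using \<open>\<And>x. f x \<le> ennreal L * indicator B x\<close>[of x] that by (auto split: split_indicator_asm)
    then show ?thesis using that(1) by (subst AE_density) auto
  qed
  note AE0 = AE_B[OF f(1) f0(2)] and AE1 = AE_B[OF f(2) f1(2)]
  have "W2 (density m f0) (density m f1) < \<infinity>"
    by (rule W2_finite_of_bounded[OF \<B> bp AE0 AE1 D])
  then obtain \<pi> \<kappa>0 \<kappa>1 where \<pi>: "\<pi> \<in> GeoOpt (density m f0) (density m f1)"
    and dis: "disintegration (endpoint_push \<pi>) (density m f0) \<kappa>0"
      "disintegration (distr (endpoint_push \<pi>) borel prod.swap) (density m f1) \<kappa>1"
    and ineq: "\<And>F t. F \<in> DC_infty \<Longrightarrow> t \<in> {0..1} \<Longrightarrow>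
             entropy_functional m F (eval_push t \<pi>) \<le>
               ereal (1 - t) * iterated_integral m \<kappa>0 (\<lambda>x0 x1.
                 CD_beta K (1 - t) x0 x1 * F (ac_density m (density m f0) x0 / CD_beta K (1 - t) x0 x1))
               + ereal t * iterated_integral m \<kappa>1 (\<lambda>x1 x0.
                 CD_beta K t x0 x1 * F (ac_density m (density m f1) x1 / CD_beta K t x0 x1))
               + slope_at_infinity F *
                   (ereal (1 - t) * enn2ereal (emeasure (singular_part m (density m f0)) UNIV)
                    + ereal t * enn2ereal (emeasure (singular_part m (density m f1)) UNIV))"
    using CD bp unfolding CD_infty_def by blast
  have s\<pi>: "sets \<pi> = sets (restrict_space borel Geo)" and "prob_space \<pi>"
    and e0: "eval_push 0 \<pi> = density m f0" and e1: "eval_push 1 \<pi> = density m f1"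
    using \<pi> unfolding GeoOpt_def by auto
  interpret \<pi>: prob_space \<pi> by fact
  note ev = eval_bcontfun_measurable[OF s\<pi>] and ends = endpoints_measurable[OF s\<pi>]
  have swap: "prod.swap \<in> (borel :: ('a \<times> 'a) measure) \<rightarrow>\<^sub>M borel"
    by (intro borel_measurable_continuous_onI continuous_on_swap)
  have snd_B: "{z. snd z \<in> B} \<in> sets (borel :: ('a \<times> 'a) measure)"
    using measurable_sets[OF borel_measurable_continuous_onI[OF continuous_on_snd[OF continuous_on_id]] B]
    by (simp add: vimage_def)
  have end0: "AE \<gamma> in \<pi>. apply_bcontfun \<gamma> 0 \<in> B"
    by (rule AE_distrD[OF ev AE0[folded e0, unfolded eval_push_def]])
  have end1: "AE \<gamma> in \<pi>. apply_bcontfun \<gamma> 1 \<in> B"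
    by (rule AE_distrD[OF ev AE1[folded e1, unfolded eval_push_def]])
  have \<sigma>1: "AE z in endpoint_push \<pi>. snd z \<in> B"
    unfolding endpoint_push_def using end1 snd_B by (subst AE_distr_iff[OF ends]) auto
  have swapped: "distr (endpoint_push \<pi>) borel prod.swap
          = distr \<pi> borel (\<lambda>\<gamma>. (apply_bcontfun \<gamma> 1, apply_bcontfun \<gamma> 0))"
    unfolding endpoint_push_def by (subst distr_distr[OF swap ends]) (simp add: comp_def)
  have ends': "(\<lambda>\<gamma>. (apply_bcontfun \<gamma> 1, apply_bcontfun \<gamma> 0)) \<in> \<pi> \<rightarrow>\<^sub>M borel"
    using measurable_compose[OF ends swap] by simp
  have \<sigma>0: "AE z in distr (endpoint_push \<pi>) borel prod.swap. snd z \<in> B"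
    unfolding swapped using end0 snd_B by (subst AE_distr_iff[OF ends']) auto
  define c where "c = L * exp (\<bar>K\<bar> * D\<^sup>2 / 6)"
  have "0 < c" unfolding c_def using \<open>0 < L\<close> by simp
  have \<beta>_pos: "0 < CD_beta K s x y" for s and x y :: 'a by (simp add: CD_beta_def)
  have \<beta>: "L \<le> c * CD_beta K s x y" if "x \<in> B" "y \<in> B" "s \<in> {0..1}" for s x y
  proof -
    have "\<bar>K\<bar> * ((1 - s\<^sup>2) * (dist x y)\<^sup>2) \<le> \<bar>K\<bar> * (1 * D\<^sup>2)"
      using that D[OF that(1,2)] by (intro mult_left_mono mult_mono power_mono) (auto simp: power_le_one)
    then have "0 \<le> \<bar>K\<bar> * D\<^sup>2 / 6 + 1/6 * K * (1 - s\<^sup>2) * (dist x y)\<^sup>2"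
      using \<open>K \<le> 0\<close> by (simp add: algebra_simps)
    then have "1 \<le> exp (\<bar>K\<bar> * D\<^sup>2 / 6 + 1/6 * K * (1 - s\<^sup>2) * (dist x y)\<^sup>2)" by simp
    then show ?thesis
      unfolding c_def CD_beta_def using mult_left_mono[of 1 _ L] \<open>0 < L\<close> by (simp add: exp_add mult.assoc)
  qed
  have "\<forall>h\<in>borel_measurable borel. (\<integral>\<^sup>+x. h x \<partial>eval_push t \<pi>) \<le> ennreal c * (\<integral>\<^sup>+x. h x \<partial>m)"
    if t: "t \<in> {0..1}" for t
  proof
    fix h :: "'a \<Rightarrow> ennreal" assume h: "h \<in> borel_measurable borel"
    have I0: "iterated_integral m \<kappa>0 (\<lambda>x0 x1. CD_beta K (1 - t) x0 x1 *
        log_excess c (ac_density m (density m f0) x0 / CD_beta K (1 - t) x0 x1)) = 0"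
      by (rule iterated_integral_log_excess_eq_0[OF m.sigma_finite_measure_axioms sm f(1) fm(1) f0(2) B dis(1) _ \<sigma>1])
        (use t \<open>0 < c\<close> \<open>0 < L\<close> \<beta> \<beta>_pos in \<open>auto simp: endpoint_push_def\<close>)
    have I1: "iterated_integral m \<kappa>1 (\<lambda>x1 x0. CD_beta K t x0 x1 *
        log_excess c (ac_density m (density m f1) x1 / CD_beta K t x0 x1)) = 0"
      by (rule iterated_integral_log_excess_eq_0[OF m.sigma_finite_measure_axioms sm f(2) fm(2) f1(2) B dis(2) _ \<sigma>0])
        (use t \<open>0 < c\<close> \<open>0 < L\<close> \<beta> \<beta>_pos in auto)
    have "entropy_functional m (log_excess c) (eval_push t \<pi>) \<le> 0"
      using ineq[OF log_excess_DC_infty[OF \<open>0 < c\<close>] t] I0 I1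
        singular_part_of_density[OF m.sigma_finite_measure_axioms fm(1) f(1)]
        singular_part_of_density[OF m.sigma_finite_measure_axioms fm(2) f(2)]
      by (simp add: spm zero_ennreal.rep_eq)
    moreover have "prob_space (eval_push t \<pi>)" unfolding eval_push_def by (rule \<pi>.prob_space_distr[OF ev])
    then have "finite_measure (eval_push t \<pi>)" by (rule prob_space.axioms)
    ultimately show "(\<integral>\<^sup>+x. h x \<partial>eval_push t \<pi>) \<le> ennreal c * (\<integral>\<^sup>+x. h x \<partial>m)"
      using \<open>0 < c\<close> h sm
      by (intro nn_integral_le_of_entropy_nonpos[OF m.sigma_finite_measure_axioms])
        (simp_all add: eval_push_def cong: measurable_cong_sets)
  qed
  with \<pi> show ?thesis unfolding c_def by blast
qed

section \<open>Geodesics and upper gradients\<close>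

lemma Geo_dist:
  assumes "\<gamma> \<in> Geo" "s \<in> {0..1}" "t \<in> {0..1}"
  shows "dist (apply_bcontfun \<gamma> s) (apply_bcontfun \<gamma> t)
           = \<bar>s - t\<bar> * dist (apply_bcontfun \<gamma> 0) (apply_bcontfun \<gamma> 1)"
  using assms unfolding Geo_def by blast

text \<open>
  Along a geodesic the sum over any subdivision telescopes.
\<close>

lemma curve_length_Geo:
  assumes "\<gamma> \<in> Geo" "0 \<le> s" "s \<le> t" "t \<le> 1"
  shows "curve_length s t (apply_bcontfun \<gamma>)
           = ennreal (t - s) * ennreal (dist (apply_bcontfun \<gamma> 0) (apply_bcontfun \<gamma> 1))"
proof -
  define d where "d = dist (apply_bcontfun \<gamma> 0) (apply_bcontfun \<gamma> 1)"
  have "0 \<le> d" unfolding d_def by simp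
  have geo: "dist (apply_bcontfun \<gamma> a) (apply_bcontfun \<gamma> b) = (b - a) * d"
    if "a \<in> {s..t}" "b \<in> {s..t}" "a \<le> b" for a b
    using Geo_dist[OF assms(1), of a b] assms that unfolding d_def by auto
  have "curve_length s t (apply_bcontfun \<gamma>) = ennreal ((t - s) * d)"
    unfolding curve_length_def
  proof (rule antisym)
    show "(SUP (n, p) \<in> {(n::nat, p::nat \<Rightarrow> real). (\<forall>i\<le>n. p i \<in> {s..t}) \<and> (\<forall>i<n. p i \<le> p (Suc i))}.
        \<Sum>i<n. ennreal (dist (apply_bcontfun \<gamma> (p i)) (apply_bcontfun \<gamma> (p (Suc i))))) \<le> ennreal ((t - s) * d)"
    proof (rule SUP_least, clarify)
      fix n :: nat and p :: "nat \<Rightarrow> real"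
      assume p: "\<forall>i\<le>n. p i \<in> {s..t}" and mono: "\<forall>i<n. p i \<le> p (Suc i)"
      have "(\<Sum>i<n. ennreal (dist (apply_bcontfun \<gamma> (p i)) (apply_bcontfun \<gamma> (p (Suc i)))))
              = (\<Sum>i<n. ennreal ((p (Suc i) - p i) * d))"
        using p mono by (intro sum.cong refl arg_cong[of _ _ ennreal] geo) auto
      also have "\<dots> = ennreal (\<Sum>i<n. (p (Suc i) - p i) * d)"
        using mono \<open>0 \<le> d\<close> by (intro sum_ennreal) auto
      also have "(\<Sum>i<n. (p (Suc i) - p i) * d) = (p n - p 0) * d"
        by (simp flip: sum_distrib_right add: sum_lessThan_telescope)
      also have "ennreal \<dots> \<le> ennreal ((t - s) * d)"
      proof -
        have "p n \<le> t" "s \<le> p 0" using p by auto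
        then show ?thesis using \<open>0 \<le> d\<close> by (intro ennreal_leI mult_right_mono) auto
      qed
      finally show "(\<Sum>i<n. ennreal (dist (apply_bcontfun \<gamma> (p i)) (apply_bcontfun \<gamma> (p (Suc i))))) \<le> ennreal ((t - s) * d)" .
    qed
    show "ennreal ((t - s) * d) \<le> (SUP (n, p) \<in> {(n::nat, p::nat \<Rightarrow> real). (\<forall>i\<le>n. p i \<in> {s..t}) \<and> (\<forall>i<n. p i \<le> p (Suc i))}.
        \<Sum>i<n. ennreal (dist (apply_bcontfun \<gamma> (p i)) (apply_bcontfun \<gamma> (p (Suc i)))))"
      using assms geo[of s t]
      by (intro SUP_upper2[of "(1, \<lambda>i. if i = 0 then s else t)"]) auto
  qed
  then show ?thesis unfolding d_def[symmetric] using assms \<open>0 \<le> d\<close> by (simp add: ennreal_mult)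
qed

lemma upper_gradient_Geo:
  assumes "upper_gradient g u" "\<gamma> \<in> Geo"
  shows "ennreal \<bar>u (apply_bcontfun \<gamma> 0) - u (apply_bcontfun \<gamma> 1)\<bar>
           \<le> ennreal (dist (apply_bcontfun \<gamma> 0) (apply_bcontfun \<gamma> 1))
               * (\<integral>\<^sup>+t\<in>{0..1}. g (apply_bcontfun \<gamma> t) \<partial>lborel)"
proof -
  have len: "curve_length 0 1 (apply_bcontfun \<gamma>) = ennreal (dist (apply_bcontfun \<gamma> 0) (apply_bcontfun \<gamma> 1))"
    using curve_length_Geo[OF assms(2), of 0 1] by simp
  have "constant_speed_curve (apply_bcontfun \<gamma>)"
    unfolding constant_speed_curve_def path_def len using curve_length_Geo[OF assms(2)] by auto
  then show ?thesis
    using assms(1) unfolding upper_gradient_def len[symmetric]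
    by (auto dest!: spec[of _ "apply_bcontfun \<gamma>"] simp: len)
qed

text \<open>
  The nearer end of the geodesic is at distance at most half of its length, which is less than \<open>r\<close>.
\<close>

lemma Geo_in_double_ball:
  assumes "\<gamma> \<in> Geo" "apply_bcontfun \<gamma> 0 \<in> ball x r" "apply_bcontfun \<gamma> 1 \<in> ball x r" "t \<in> {0..1}"
  shows "apply_bcontfun \<gamma> t \<in> ball x (2 * r)"
proof -
  define d where "d = dist (apply_bcontfun \<gamma> 0) (apply_bcontfun \<gamma> 1)"
  have d: "d < 2 * r"
    using dist_triangle2[of "apply_bcontfun \<gamma> 0" "apply_bcontfun \<gamma> 1" x] assms(2,3)
    unfolding d_def by (auto simp: dist_commute)
  have "0 \<le> d" unfolding d_def by simp
  have geo: "dist (apply_bcontfun \<gamma> s) (apply_bcontfun \<gamma> t) = \<bar>s - t\<bar> * d" if "s \<in> {0..1}" for s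
    using Geo_dist[OF assms(1) that assms(4)] unfolding d_def .
  show ?thesis
  proof (cases "t \<le> 1 / 2")
    case True
    then have "t * d \<le> 1 / 2 * d" using \<open>0 \<le> d\<close> by (intro mult_right_mono)
    then show ?thesis
      using geo[of 0] assms d dist_triangle[of x "apply_bcontfun \<gamma> t" "apply_bcontfun \<gamma> 0"] by auto
  next
    case False
    then have "(1 - t) * d \<le> 1 / 2 * d" using \<open>0 \<le> d\<close> by (intro mult_right_mono) auto
    then show ?thesis
      using geo[of 1] assms d dist_triangle[of x "apply_bcontfun \<gamma> t" "apply_bcontfun \<gamma> 1"] by auto
  qed
qed

section \<open>Medians and means\<close>

text \<open>
  The infimum of the levels at which the distribution function of \<open>u\<close> has reached half of the mass
  is a median: right-continuity bounds the mass above it, the left limit the mass below it.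
\<close>

lemma (in finite_measure) median_exists:
  fixes u :: "'a \<Rightarrow> real"
  assumes u[measurable]: "u \<in> borel_measurable M" and pos: "0 < measure M (space M)"
  shows "\<exists>c. measure M {y\<in>space M. u y < c} \<le> measure M (space M) / 2 \<and>
             measure M {y\<in>space M. c < u y} \<le> measure M (space M) / 2"
proof -
  define N where "N = distr M borel u"
  interpret N: finite_borel_measure N
    unfolding N_def using finite_measure_distr[OF u]
    by (simp add: finite_borel_measure_def finite_borel_measure_axioms_def)
  define v where "v = measure M (space M)"
  have v: "measure N (space N) = v" unfolding N_def v_def by (simp add: measure_distr)
  define S where "S = {s. v / 2 \<le> cdf N s}"
  have "\<forall>\<^sub>F s in at_top. v / 2 < cdf N s"
    using N.cdf_lim_at_top pos unfolding v v_def[symmetric] by (intro order_tendstoD) auto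
  then have "S \<noteq> {}" unfolding S_def by (auto simp: eventually_at_top_linorder intro: less_imp_le)
  have "\<forall>\<^sub>F s in at_bot. cdf N s < v / 2"
    using N.cdf_lim_at_bot pos unfolding v_def[symmetric] by (intro order_tendstoD) auto
  then obtain b where "\<And>s. s \<le> b \<Longrightarrow> cdf N s < v / 2" by (auto simp: eventually_at_bot_linorder)
  then have bdd: "bdd_below S"
    unfolding S_def by (intro bdd_belowI[of _ b]) (metis linorder_le_cases mem_Collect_eq not_le)
  define c where "c = Inf S"
  have "\<forall>\<^sub>F s in at_right c. v / 2 \<le> cdf N s"
    unfolding eventually_at_right_field
  proof (intro exI[of _ "c + 1"] conjI allI impI)
    fix s assume "c < s" "s < c + 1"
    then obtain s' where "s' \<in> S" "s' < s"
      unfolding c_def using cInf_lessD[OF \<open>S \<noteq> {}\<close>] by blast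
    then show "v / 2 \<le> cdf N s" using N.cdf_nondecreasing[of s' s] unfolding S_def by simp
  qed simp
  then have half: "v / 2 \<le> cdf N c"
    using N.cdf_is_right_cont[of c] unfolding continuous_within
    by (intro tendsto_lowerbound) auto
  have "\<forall>\<^sub>F s in at_left c. cdf N s \<le> v / 2"
    unfolding eventually_at_left_field
  proof (intro exI[of _ "c - 1"] conjI allI impI)
    fix s assume "c - 1 < s" "s < c"
    then have "s \<notin> S" using cInf_lower[OF _ bdd, of s] unfolding c_def by auto
    then show "cdf N s \<le> v / 2" unfolding S_def by simp
  qed simp
  then have "measure N {..<c} \<le> v / 2"
    using N.cdf_at_left[of c] by (intro tendsto_upperbound) auto
  moreover have "measure N {..<c} = measure M {y\<in>space M. u y < c}"
    unfolding N_def by (subst measure_distr) (auto intro!: arg_cong[of _ _ "measure M"])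
  moreover have "cdf N c = v - measure M {y\<in>space M. c < u y}"
  proof -
    have "cdf N c = measure M (space M - {y\<in>space M. c < u y})"
      unfolding N_def cdf_def by (subst measure_distr) (auto intro!: arg_cong[of _ _ "measure M"])
    then show ?thesis unfolding v_def by (simp add: finite_measure_compl)
  qed
  ultimately show ?thesis using half unfolding v_def by auto
qed

text \<open>
  The level set of the median may carry mass, and the measure may have atoms, so that the space
  need not split into two sets of equal measure. Sharing the level set between the two halves in the
  proportion \<open>\<theta> : 1 - \<theta>\<close> replaces this.
\<close>

lemma (in finite_measure) median_split_exists:
  fixes u :: "'a \<Rightarrow> real"
  assumes [measurable]: "u \<in> borel_measurable M" and pos: "0 < measure M (space M)"
  obtains c \<theta> :: real where "0 \<le> \<theta>" "\<theta> \<le> 1"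
    and "measure M {y\<in>space M. c < u y} + \<theta> * measure M {y\<in>space M. u y = c} = measure M (space M) / 2"
    and "measure M {y\<in>space M. u y < c} + (1 - \<theta>) * measure M {y\<in>space M. u y = c} = measure M (space M) / 2"
proof -
  obtain c where c: "measure M {y\<in>space M. u y < c} \<le> measure M (space M) / 2"
    "measure M {y\<in>space M. c < u y} \<le> measure M (space M) / 2"
    using median_exists[OF assms] by blast
  define a b e where "a = measure M {y\<in>space M. u y < c}"
    and "b = measure M {y\<in>space M. c < u y}" and "e = measure M {y\<in>space M. u y = c}"
  have "a + e + b = measure M ({y\<in>space M. u y < c} \<union> {y\<in>space M. u y = c} \<union> {y\<in>space M. c < u y})"
    unfolding a_def b_def e_def
    by (subst finite_measure_Union; (subst finite_measure_Union)?) (auto)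
  also have "{y\<in>space M. u y < c} \<union> {y\<in>space M. u y = c} \<union> {y\<in>space M. c < u y} = space M" by auto
  finally have sum: "a + e + b = measure M (space M)" .
  show thesis
  proof (cases "e = 0")
    case True
    show thesis by (rule that[of 0 c]) (use c sum True in \<open>simp_all add: a_def b_def e_def\<close>)
  next
    case False
    then have "0 < e" unfolding e_def by (simp add: zero_less_measure_iff)
    define \<theta> where "\<theta> = (measure M (space M) / 2 - b) / e"
    have \<theta>: "\<theta> * e = measure M (space M) / 2 - b" unfolding \<theta>_def using False by simp
    show thesis
    proof (rule that[of \<theta> c, folded a_def b_def e_def])
      show "0 \<le> \<theta>" unfolding \<theta>_def using c \<open>0 < e\<close> by (simp add: b_def)
      show "\<theta> \<le> 1" unfolding \<theta>_def using c sum \<open>0 < e\<close> by (simp add: a_def)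
      show "b + \<theta> * e = measure M (space M) / 2" "a + (1 - \<theta>) * e = measure M (space M) / 2"
        using \<theta> sum by (simp_all add: algebra_simps)
    qed
  qed
qed

text \<open>
  Replacing a constant by the mean costs at most a factor \<open>2\<close>, as the mean of \<open>u\<close> differs from \<open>c\<close> by
  at most the mean of \<open>\<bar>u - c\<bar>\<close>.
\<close>

lemma (in finite_measure) mean_deviation_le:
  fixes u :: "'a \<Rightarrow> real"
  assumes [measurable]: "u \<in> borel_measurable M"
    and fin: "(\<integral>\<^sup>+y. ennreal \<bar>u y - c\<bar> \<partial>M) < \<infinity>"
  shows "(\<integral>\<^sup>+y. ennreal \<bar>u y - (LINT y|M. u y) / measure M (space M)\<bar> \<partial>M)
           \<le> 2 * (\<integral>\<^sup>+y. ennreal \<bar>u y - c\<bar> \<partial>M)"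
proof -
  define a where "a = (LINT y|M. u y) / measure M (space M)"
  have int: "integrable M (\<lambda>y. u y - c)" using fin by (intro integrableI_bounded) auto
  have uint: "integrable M u"
    using Bochner_Integration.integrable_add[OF int integrable_const[of c]] by simp
  have eq: "(\<integral>\<^sup>+y. ennreal \<bar>u y - c\<bar> \<partial>M) = ennreal (LINT y|M. \<bar>u y - c\<bar>)"
    by (intro nn_integral_eq_integral integrable_abs int) auto
  have "measure M (space M) * \<bar>a - c\<bar> \<le> (LINT y|M. \<bar>u y - c\<bar>)"
  proof (cases "measure M (space M) = 0")
    case False
    have "(LINT y|M. u y - c) = (LINT y|M. u y) - c * measure M (space M)"
      using uint by (simp add: mult.commute)
    also have "\<dots> = measure M (space M) * (a - c)" unfolding a_def using False by (simp add: field_simps)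
    finally have "measure M (space M) * \<bar>a - c\<bar> = \<bar>LINT y|M. u y - c\<bar>"
      by (simp add: abs_mult)
    then show ?thesis using integral_abs_bound[of M "\<lambda>y. u y - c"] by simp
  qed (simp add: integral_nonneg_AE)
  then have const: "(\<integral>\<^sup>+y. ennreal \<bar>a - c\<bar> \<partial>M) \<le> (\<integral>\<^sup>+y. ennreal \<bar>u y - c\<bar> \<partial>M)"
    unfolding eq by (simp add: emeasure_eq_measure ennreal_mult[symmetric] mult.commute ennreal_leI)
  have "(\<integral>\<^sup>+y. ennreal \<bar>u y - a\<bar> \<partial>M) \<le> (\<integral>\<^sup>+y. ennreal \<bar>u y - c\<bar> + ennreal \<bar>a - c\<bar> \<partial>M)"
    by (intro nn_integral_mono) (auto simp flip: ennreal_plus intro!: ennreal_leI)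
  also have "\<dots> = (\<integral>\<^sup>+y. ennreal \<bar>u y - c\<bar> \<partial>M) + (\<integral>\<^sup>+y. ennreal \<bar>a - c\<bar> \<partial>M)"
    by (intro nn_integral_add) auto
  also have "\<dots> \<le> 2 * (\<integral>\<^sup>+y. ennreal \<bar>u y - c\<bar> \<partial>M)"
    using add_left_mono[OF const] by (simp add: mult_2)
  finally show ?thesis unfolding a_def .
qed

section \<open>The local Poincare inequality\<close>

text \<open>
  Mass sitting where \<open>u \<ge> c\<close> is transported to where \<open>u \<le> c\<close>. On such a curve \<open>c\<close> separates the values
  of \<open>u\<close> at the two ends, so that the deviations from \<open>c\<close> there add up to the difference
  of these values, with no loss; the upper gradient bounds this difference by the length, at most
  \<open>2 r\<close>, times the mean of \<open>g\<close> along the curve. Averaging over the curves first turns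
  that mean into integrals of \<open>g\<close> against the intermediate measures.
\<close>

lemma CD_infty_transport_estimate:
  fixes m :: "'a::complete_space measure"
  assumes CD: "CD_infty K m" "K \<le> 0" and u: "continuous_on UNIV u" and g: "upper_gradient g u"
    and "0 < r" "0 < L"
    and f0: "f0 \<in> borel_measurable borel" "\<And>y. f0 y \<le> ennreal L * indicator (ball x r) y" "(\<integral>\<^sup>+y. f0 y \<partial>m) = 1"
    and f1: "f1 \<in> borel_measurable borel" "\<And>y. f1 y \<le> ennreal L * indicator (ball x r) y" "(\<integral>\<^sup>+y. f1 y \<partial>m) = 1"
    and above: "\<And>y. 0 < f0 y \<Longrightarrow> c \<le> u y" and below: "\<And>y. 0 < f1 y \<Longrightarrow> u y \<le> c"
  shows "(\<integral>\<^sup>+y. ennreal \<bar>u y - c\<bar> * (f0 y + f1 y) \<partial>m)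
           \<le> ennreal (2 * r * (L * exp (\<bar>K\<bar> * (2 * r)\<^sup>2 / 6))) * (\<integral>\<^sup>+y\<in>ball x (2 * r). g y \<partial>m)"
proof -
  have sm: "sets m = sets borel"
    using CD unfolding CD_infty_def metric_measure_space_def by auto
  have [measurable]: "f0 \<in> borel_measurable m" "f1 \<in> borel_measurable m"
    using f0(1) f1(1) sm by (simp_all cong: measurable_cong_sets)
  have u_borel[measurable]: "u \<in> borel_measurable borel" using u by (rule borel_measurable_continuous_onI)
  then have [measurable]: "u \<in> borel_measurable m" using sm by (simp cong: measurable_cong_sets)
  have g_borel[measurable]: "g \<in> borel_measurable borel" using g unfolding upper_gradient_def by auto
  define G where "G = (\<lambda>y. g y * indicator (ball x (2 * r)) y)"
  have [measurable]: "ball x (2 * r) \<in> sets borel" by simp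
  have G[measurable]: "G \<in> borel_measurable borel" unfolding G_def by measurable
  define C where "C = L * exp (\<bar>K\<bar> * (2 * r)\<^sup>2 / 6)"
  have "0 \<le> C" unfolding C_def using \<open>0 < L\<close> by simp
  have "dist y z \<le> 2 * r" if "y \<in> ball x r" "z \<in> ball x r" for y z
    using that dist_triangle3[of y z x] by auto
  then obtain \<pi> where \<pi>: "\<pi> \<in> GeoOpt (density m f0) (density m f1)"
    and dens: "\<And>t h. t \<in> {0..1} \<Longrightarrow> h \<in> borel_measurable borel \<Longrightarrow>
           (\<integral>\<^sup>+x. h x \<partial>eval_push t \<pi>) \<le> ennreal C * (\<integral>\<^sup>+x. h x \<partial>m)"
    using CD_infty_density_bound[OF CD \<open>0 < L\<close> _ _ f0 f1, of "2 * r"] unfolding C_def by auto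
  have s\<pi>: "sets \<pi> = sets (restrict_space borel Geo)" and "prob_space \<pi>"
    and e0: "eval_push 0 \<pi> = density m f0" and e1: "eval_push 1 \<pi> = density m f1"
    using \<pi> unfolding GeoOpt_def by auto
  interpret \<pi>: prob_space \<pi> by fact
  interpret pair_sigma_finite \<pi> lborel ..
  note ev[measurable] = eval_bcontfun_measurable[OF s\<pi>]
  have push: "(\<integral>\<^sup>+y. h y \<partial>eval_push t \<pi>) = (\<integral>\<^sup>+\<gamma>. h (apply_bcontfun \<gamma> t) \<partial>\<pi>)"
    if "h \<in> borel_measurable borel" for h :: "'a \<Rightarrow> ennreal" and t
    unfolding eval_push_def using that by (intro nn_integral_distr[OF ev]) simp
  have end0: "AE \<gamma> in \<pi>. apply_bcontfun \<gamma> 0 \<in> ball x r \<and> c \<le> u (apply_bcontfun \<gamma> 0)"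
  proof -
    have "y \<in> ball x r \<and> c \<le> u y" if "0 < f0 y" for y
      using f0(2)[of y] above[OF that] that by (auto split: split_indicator_asm)
    then have "AE y in density m f0. y \<in> ball x r \<and> c \<le> u y" by (subst AE_density) auto
    from AE_distrD[OF ev this[folded e0, unfolded eval_push_def]] show ?thesis .
  qed
  have end1: "AE \<gamma> in \<pi>. apply_bcontfun \<gamma> 1 \<in> ball x r \<and> u (apply_bcontfun \<gamma> 1) \<le> c"
  proof -
    have "y \<in> ball x r \<and> u y \<le> c" if "0 < f1 y" for y
      using f1(2)[of y] below[OF that] that by (auto split: split_indicator_asm)
    then have "AE y in density m f1. y \<in> ball x r \<and> u y \<le> c" by (subst AE_density) auto
    from AE_distrD[OF ev this[folded e1, unfolded eval_push_def]] show ?thesis .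
  qed
  have "space \<pi> = Geo" using sets_eq_imp_space_eq[OF s\<pi>] by (simp add: space_restrict_space)
  then have "AE \<gamma> in \<pi>. \<gamma> \<in> Geo" using AE_space[of \<pi>] by simp
  with end0 end1 have along: "AE \<gamma> in \<pi>. ennreal \<bar>u (apply_bcontfun \<gamma> 0) - c\<bar> + ennreal \<bar>u (apply_bcontfun \<gamma> 1) - c\<bar>
      \<le> ennreal (2 * r) * (\<integral>\<^sup>+t. G (apply_bcontfun \<gamma> t) * indicator {0..1} t \<partial>lborel)"
  proof eventually_elim
    case (elim \<gamma>)
    have "ennreal \<bar>u (apply_bcontfun \<gamma> 0) - c\<bar> + ennreal \<bar>u (apply_bcontfun \<gamma> 1) - c\<bar>
        = ennreal \<bar>u (apply_bcontfun \<gamma> 0) - u (apply_bcontfun \<gamma> 1)\<bar>"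
      using elim by (simp flip: ennreal_plus)
    also have "\<dots> \<le> ennreal (dist (apply_bcontfun \<gamma> 0) (apply_bcontfun \<gamma> 1))
               * (\<integral>\<^sup>+t\<in>{0..1}. g (apply_bcontfun \<gamma> t) \<partial>lborel)"
      using elim by (intro upper_gradient_Geo[OF g]) auto
    also have "(\<integral>\<^sup>+t\<in>{0..1}. g (apply_bcontfun \<gamma> t) \<partial>lborel)
        = (\<integral>\<^sup>+t. G (apply_bcontfun \<gamma> t) * indicator {0..1} t \<partial>lborel)"
    proof (rule nn_integral_cong)
      fix t :: real
      show "g (apply_bcontfun \<gamma> t) * indicator {0..1} t = G (apply_bcontfun \<gamma> t) * indicator {0..1} t"
        using Geo_in_double_ball[of \<gamma> x r t] elim unfolding G_def by (cases "t \<in> {0..1}") auto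
    qed
    also have "dist (apply_bcontfun \<gamma> 0) (apply_bcontfun \<gamma> 1) \<le> 2 * r"
      using elim dist_triangle3[of "apply_bcontfun \<gamma> 0" "apply_bcontfun \<gamma> 1" x] by auto
    finally show ?case by (simp add: ennreal_leI mult_right_mono)
  qed
  have joint: "(\<lambda>(\<gamma>, t). G (apply_bcontfun \<gamma> t) * indicator {0..1} t) \<in> borel_measurable (\<pi> \<Otimes>\<^sub>M lborel)"
    using measurable_compose[OF joint_eval_bcontfun_measurable[OF s\<pi>] G]
    unfolding case_prod_beta' by (intro borel_measurable_times_ennreal) auto
  have "(\<integral>\<^sup>+y. ennreal \<bar>u y - c\<bar> * (f0 y + f1 y) \<partial>m)
      = (\<integral>\<^sup>+y. f0 y * ennreal \<bar>u y - c\<bar> \<partial>m) + (\<integral>\<^sup>+y. f1 y * ennreal \<bar>u y - c\<bar> \<partial>m)"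
    by (subst nn_integral_add[symmetric]) (auto simp: algebra_simps)
  also have "\<dots> = (\<integral>\<^sup>+y. ennreal \<bar>u y - c\<bar> \<partial>eval_push 0 \<pi>) + (\<integral>\<^sup>+y. ennreal \<bar>u y - c\<bar> \<partial>eval_push 1 \<pi>)"
    unfolding e0 e1 by (simp add: nn_integral_density)
  also have "\<dots> = (\<integral>\<^sup>+\<gamma>. ennreal \<bar>u (apply_bcontfun \<gamma> 0) - c\<bar> + ennreal \<bar>u (apply_bcontfun \<gamma> 1) - c\<bar> \<partial>\<pi>)"
    by (subst nn_integral_add) (auto simp: push)
  also have "\<dots> \<le> (\<integral>\<^sup>+\<gamma>. ennreal (2 * r) * (\<integral>\<^sup>+t. G (apply_bcontfun \<gamma> t) * indicator {0..1} t \<partial>lborel) \<partial>\<pi>)"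
    by (rule nn_integral_mono_AE[OF along])
  also have "\<dots> = ennreal (2 * r) * (\<integral>\<^sup>+\<gamma>. (\<integral>\<^sup>+t. G (apply_bcontfun \<gamma> t) * indicator {0..1} t \<partial>lborel) \<partial>\<pi>)"
  proof -
    have "(\<lambda>\<gamma>. \<integral>\<^sup>+t. G (apply_bcontfun \<gamma> t) * indicator {0..1} t \<partial>lborel) \<in> borel_measurable \<pi>"
      by (rule sigma_finite_measure.borel_measurable_nn_integral[OF sigma_finite_lborel joint])
    then show ?thesis by (rule nn_integral_cmult)
  qed
  also have "(\<integral>\<^sup>+\<gamma>. (\<integral>\<^sup>+t. G (apply_bcontfun \<gamma> t) * indicator {0..1} t \<partial>lborel) \<partial>\<pi>)
      = (\<integral>\<^sup>+t. (\<integral>\<^sup>+\<gamma>. G (apply_bcontfun \<gamma> t) * indicator {0..1} t \<partial>\<pi>) \<partial>lborel)"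
    by (rule Fubini'[symmetric, OF joint])
  also have "\<dots> \<le> (\<integral>\<^sup>+t. ennreal C * (\<integral>\<^sup>+y. G y \<partial>m) * indicator {0..1::real} t \<partial>lborel)"
  proof (rule nn_integral_mono)
    fix t :: real
    show "(\<integral>\<^sup>+\<gamma>. G (apply_bcontfun \<gamma> t) * indicator {0..1} t \<partial>\<pi>)
        \<le> ennreal C * (\<integral>\<^sup>+y. G y \<partial>m) * indicator {0..1} t"
      using dens[OF _ G, of t] by (cases "t \<in> {0..1}") (auto simp: push)
  qed
  also have "\<dots> = ennreal C * (\<integral>\<^sup>+y. G y \<partial>m)"
    by (subst nn_integral_cmult_indicator) auto
  finally show ?thesis
    using \<open>0 \<le> C\<close> \<open>0 < r\<close> unfolding G_def C_def[symmetric]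
    by (simp add: mult_left_mono ennreal_mult mult.assoc)
qed

text \<open>
  The two halves of the ball below and above the median, each with density at most \<open>2 / m(B)\<close>,
  are transported onto each other. The normalisation cancels against the density bound.
\<close>

lemma CD_infty_deviation_from_median:
  fixes m :: "'a::complete_space measure"
  assumes CD: "CD_infty K m" "K \<le> 0" and u: "continuous_on UNIV u" and g: "upper_gradient g u"
    and "0 < r"
  shows "\<exists>c. (\<integral>\<^sup>+y\<in>ball x r. ennreal \<bar>u y - c\<bar> \<partial>m)
           \<le> ennreal (2 * r * exp (\<bar>K\<bar> * (2 * r)\<^sup>2 / 6)) * (\<integral>\<^sup>+y\<in>ball x (2 * r). g y \<partial>m)"
proof -
  have sm: "sets m = sets borel" and fin: "emeasure m (ball x r) < \<infinity>" and "x \<in> support m"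
    using CD unfolding CD_infty_def metric_measure_space_def by auto
  then have [simp]: "space m = UNIV" by (auto dest: sets_eq_imp_space_eq)
  have pos: "0 < emeasure m (ball x r)" using \<open>x \<in> support m\<close> \<open>0 < r\<close> unfolding support_def by blast
  have u_borel[measurable]: "u \<in> borel_measurable borel" using u by (rule borel_measurable_continuous_onI)
  then have [measurable]: "u \<in> borel_measurable m" using sm by (simp cong: measurable_cong_sets)
  have ball[measurable]: "ball x r \<in> sets m" using sm by simp
  define V where "V = measure m (ball x r)"
  have "0 < V" using pos fin unfolding V_def measure_def by (simp add: enn2real_positive_iff)
  define N where "N = restrict_space m (ball x r)"
  interpret N: finite_measure N
    unfolding N_def using fin ball
    by (intro finite_measureI) (simp add: emeasure_restrict_space space_restrict_space)
  have N: "space N = ball x r" "measure N (space N) = V"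
    unfolding N_def V_def by (simp_all add: space_restrict_space measure_restrict_space)
  have mN: "measure N A = measure m A" if "A \<subseteq> ball x r" for A
    unfolding N_def using that by (simp add: measure_restrict_space)
  have uN: "u \<in> borel_measurable N" unfolding N_def by (intro measurable_restrict_space1) simp
  obtain c \<theta> :: real where \<theta>: "0 \<le> \<theta>" "\<theta> \<le> 1"
    and split: "measure N {y\<in>space N. c < u y} + \<theta> * measure N {y\<in>space N. u y = c} = V / 2"
      "measure N {y\<in>space N. u y < c} + (1 - \<theta>) * measure N {y\<in>space N. u y = c} = V / 2"
    by (rule N.median_split_exists[OF uN, unfolded N(2), OF \<open>0 < V\<close>])
  define P E Q where "P = {y\<in>ball x r. c < u y}" and "E = {y\<in>ball x r. u y = c}"
    and "Q = {y\<in>ball x r. u y < c}"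
  have PEQ[measurable]: "P \<in> sets borel" "E \<in> sets borel" "Q \<in> sets borel"
  proof -
    have "P = ball x r \<inter> {y\<in>space borel. c < u y}" "E = ball x r \<inter> {y\<in>space borel. u y = c}"
      "Q = ball x r \<inter> {y\<in>space borel. u y < c}"
      unfolding P_def E_def Q_def by auto
    then show "P \<in> sets borel" "E \<in> sets borel" "Q \<in> sets borel" by simp_all
  qed
  \<comment> \<open>Multiplying by \<open>2 / V\<close> turns a half of the ball into a probability measure.\<close>
  define f where "f = (\<lambda>A \<theta> y. ennreal (2 / V) * (indicator A y + ennreal \<theta> * indicator E y) :: ennreal)"
  have f_borel: "f A \<theta> \<in> borel_measurable borel" if "A \<in> sets borel" for A \<theta>
    unfolding f_def using that by measurable
  have f_le: "f A \<theta> y \<le> ennreal (2 / V) * indicator (ball x r) y"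
    if "A \<subseteq> ball x r" "A \<inter> E = {}" "0 \<le> \<theta>" "\<theta> \<le> 1" for A \<theta> y
  proof -
    have "indicator A y + ennreal \<theta> * indicator E y \<le> (indicator (ball x r) y :: ennreal)"
      using that by (auto split: split_indicator simp: E_def)
    then show ?thesis unfolding f_def by (rule mult_left_mono) simp
  qed
  have f_int: "(\<integral>\<^sup>+y. f A \<theta> y \<partial>m) = 1"
    if "A \<in> sets borel" "A \<subseteq> ball x r" "0 \<le> \<theta>" "measure m A + \<theta> * measure m E = V / 2" for A \<theta>
  proof -
    have [measurable]: "A \<in> sets m" "E \<in> sets m" using that sm by auto
    have "emeasure m B = ennreal (measure m B)" if "B \<subseteq> ball x r" for B
      using emeasure_mono[OF that ball] fin by (intro emeasure_eq_ennreal_measure) (auto simp: top_unique)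
    moreover have "E \<subseteq> ball x r" unfolding E_def by auto
    ultimately have "emeasure m A = ennreal (measure m A)" "emeasure m E = ennreal (measure m E)"
      using that(2) by blast+
    then
    have "emeasure m A + ennreal \<theta> * emeasure m E = ennreal (V / 2)"
      unfolding that(4)[symmetric] using that(3) by (simp add: ennreal_mult)
    moreover have "(\<integral>\<^sup>+y. f A \<theta> y \<partial>m) = ennreal (2 / V) * (emeasure m A + ennreal \<theta> * emeasure m E)"
      unfolding f_def by (simp add: nn_integral_cmult nn_integral_add)
    ultimately show ?thesis using \<open>0 < V\<close> by (simp flip: ennreal_mult)
  qed
  have "P \<subseteq> ball x r" "P \<inter> E = {}" "Q \<subseteq> ball x r" "Q \<inter> E = {}" "E \<subseteq> ball x r"
    unfolding P_def E_def Q_def by auto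
  note sub = this
  have split': "measure m P + \<theta> * measure m E = V / 2" "measure m Q + (1 - \<theta>) * measure m E = V / 2"
    using split mN[OF sub(1)] mN[OF sub(3)] mN[OF sub(5)] unfolding N(1) P_def E_def Q_def by auto
  have "(\<integral>\<^sup>+y. ennreal \<bar>u y - c\<bar> * (f P \<theta> y + f Q (1 - \<theta>) y) \<partial>m)
      \<le> ennreal (2 * r * ((2 / V) * exp (\<bar>K\<bar> * (2 * r)\<^sup>2 / 6))) * (\<integral>\<^sup>+y\<in>ball x (2 * r). g y \<partial>m)"
  proof (rule CD_infty_transport_estimate[OF CD u g \<open>0 < r\<close>])
    show "0 < 2 / V" using \<open>0 < V\<close> by simp
    show "c \<le> u y" if "0 < f P \<theta> y" for y
      using that unfolding f_def P_def E_def by (auto split: split_indicator_asm)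
    show "u y \<le> c" if "0 < f Q (1 - \<theta>) y" for y
      using that unfolding f_def Q_def E_def by (auto split: split_indicator_asm)
  qed (use \<theta> sub split' PEQ f_borel f_le f_int in auto)
  also have "\<dots> = ennreal (2 / V) * (ennreal (2 * r * exp (\<bar>K\<bar> * (2 * r)\<^sup>2 / 6)) * (\<integral>\<^sup>+y\<in>ball x (2 * r). g y \<partial>m))"
  proof -
    have "2 * r * ((2 / V) * exp (\<bar>K\<bar> * (2 * r)\<^sup>2 / 6)) = (2 / V) * (2 * r * exp (\<bar>K\<bar> * (2 * r)\<^sup>2 / 6))"
      by (rule mult.left_commute)
    moreover have "ennreal ((2 / V) * (2 * r * exp (\<bar>K\<bar> * (2 * r)\<^sup>2 / 6)))
        = ennreal (2 / V) * ennreal (2 * r * exp (\<bar>K\<bar> * (2 * r)\<^sup>2 / 6))"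
      using \<open>0 < V\<close> \<open>0 < r\<close> by (intro ennreal_mult) auto
    ultimately show ?thesis by (simp only: mult.assoc)
  qed
  also have "(\<integral>\<^sup>+y. ennreal \<bar>u y - c\<bar> * (f P \<theta> y + f Q (1 - \<theta>) y) \<partial>m)
      = (\<integral>\<^sup>+y. ennreal (2 / V) * (ennreal \<bar>u y - c\<bar> * indicator (ball x r) y) \<partial>m)"
    unfolding f_def P_def Q_def E_def by (intro nn_integral_cong) (auto split: split_indicator simp: mult_ac)
  also have "\<dots> = ennreal (2 / V) * (\<integral>\<^sup>+y\<in>ball x r. ennreal \<bar>u y - c\<bar> \<partial>m)"
    by (rule nn_integral_cmult) measurable
  finally have "(\<integral>\<^sup>+y\<in>ball x r. ennreal \<bar>u y - c\<bar> \<partial>m)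
      \<le> ennreal (2 * r * exp (\<bar>K\<bar> * (2 * r)\<^sup>2 / 6)) * (\<integral>\<^sup>+y\<in>ball x (2 * r). g y \<partial>m)"
    using \<open>0 < V\<close> by (simp add: ennreal_mult_le_mult_iff)
  then show ?thesis by blast
qed

theorem theorem1p1:
  fixes K :: real and m :: "'a::complete_space measure"
    and u :: "'a \<Rightarrow> real" and g :: "'a \<Rightarrow> ennreal" and x :: 'a and r :: real
  assumes "K \<le> 0"
    and "CD_infty K m"
    and "continuous_on UNIV u"
    and "upper_gradient g u"
    and "r > 0"
  shows "(\<integral>\<^sup>+y\<in>ball x r. ennreal \<bar>u y - average m (ball x r) u\<bar> \<partial>m)
           \<le> ennreal (4 * r * exp (\<bar>K\<bar> * r\<^sup>2)) * (\<integral>\<^sup>+y\<in>ball x (2 * r). g y \<partial>m)"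
proof -
  define I where "I = (\<integral>\<^sup>+y\<in>ball x (2 * r). g y \<partial>m)"
  have sm: "sets m = sets borel" and fin: "emeasure m (ball x r) < \<infinity>"
    using assms(2) unfolding CD_infty_def metric_measure_space_def by auto
  then have [simp]: "space m = UNIV" by (auto dest: sets_eq_imp_space_eq)
  have ball: "ball x r \<in> sets m" using sm by simp
  obtain c where c: "(\<integral>\<^sup>+y\<in>ball x r. ennreal \<bar>u y - c\<bar> \<partial>m)
      \<le> ennreal (2 * r * exp (\<bar>K\<bar> * (2 * r)\<^sup>2 / 6)) * I"
    using CD_infty_deviation_from_median[OF assms(2,1,3-5)] unfolding I_def by blast
  have "2 * (\<integral>\<^sup>+y\<in>ball x r. ennreal \<bar>u y - c\<bar> \<partial>m)
      \<le> 2 * (ennreal (2 * r * exp (\<bar>K\<bar> * (2 * r)\<^sup>2 / 6)) * I)"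
    using c by (rule mult_left_mono) simp
  also have "\<dots> = ennreal (4 * r * exp (\<bar>K\<bar> * (2 * r)\<^sup>2 / 6)) * I"
  proof -
    have "2 * ennreal (2 * r * exp (\<bar>K\<bar> * (2 * r)\<^sup>2 / 6)) = ennreal (2 * (2 * r * exp (\<bar>K\<bar> * (2 * r)\<^sup>2 / 6)))"
      using \<open>r > 0\<close> by (subst ennreal_mult) auto
    then show ?thesis by (simp add: mult.assoc[symmetric])
  qed
  also have "\<dots> \<le> ennreal (4 * r * exp (\<bar>K\<bar> * r\<^sup>2)) * I"
  proof -
    have "\<bar>K\<bar> * (2 * r)\<^sup>2 / 6 \<le> \<bar>K\<bar> * r\<^sup>2" using \<open>r > 0\<close> by (simp add: power2_eq_square)
    then show ?thesis using \<open>r > 0\<close> by (intro mult_right_mono ennreal_leI mult_left_mono) auto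
  qed
  finally have bound: "2 * (\<integral>\<^sup>+y\<in>ball x r. ennreal \<bar>u y - c\<bar> \<partial>m) \<le> ennreal (4 * r * exp (\<bar>K\<bar> * r\<^sup>2)) * I" .
  show ?thesis
  proof (cases "(\<integral>\<^sup>+y\<in>ball x r. ennreal \<bar>u y - c\<bar> \<partial>m) < \<infinity>")
    \<comment> \<open>Here \<open>u\<close> is not integrable on the ball and its average is the default value \<open>0\<close>, but then
      the right-hand side is infinite.\<close>
    case False
    then have "2 * (\<integral>\<^sup>+y\<in>ball x r. ennreal \<bar>u y - c\<bar> \<partial>m) = \<infinity>"
      by (simp add: less_top[symmetric] ennreal_mult_eq_top_iff)
    then have "ennreal (4 * r * exp (\<bar>K\<bar> * r\<^sup>2)) * I = \<infinity>" using bound by (simp add: top_unique)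
    then show ?thesis unfolding I_def by simp
  next
    case True
    define N where "N = restrict_space m (ball x r)"
    interpret N: finite_measure N
      unfolding N_def using fin ball
    by (intro finite_measureI) (simp add: emeasure_restrict_space space_restrict_space)
    have "u \<in> borel_measurable m"
      using borel_measurable_continuous_onI[OF assms(3)] sm by (simp cong: measurable_cong_sets)
    then have uN: "u \<in> borel_measurable N" unfolding N_def by (rule measurable_restrict_space1)
    have nn: "(\<integral>\<^sup>+y. h y \<partial>N) = (\<integral>\<^sup>+y\<in>ball x r. h y \<partial>m)" for h :: "'a \<Rightarrow> ennreal"
      unfolding N_def using ball by (intro nn_integral_restrict_space) simp
    have "(LINT y|N. u y) / measure N (space N) = average m (ball x r) u"
      unfolding N_def average_def set_lebesgue_integral_def using ball
      by (simp add: integral_restrict_space measure_restrict_space space_restrict_space)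
    with N.mean_deviation_le[OF uN, of c] True
    have "(\<integral>\<^sup>+y\<in>ball x r. ennreal \<bar>u y - average m (ball x r) u\<bar> \<partial>m)
        \<le> 2 * (\<integral>\<^sup>+y\<in>ball x r. ennreal \<bar>u y - c\<bar> \<partial>m)"
      unfolding nn by simp
    with bound show ?thesis unfolding I_def by (rule order.trans[rotated])
  qed
qed

end
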